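(* Let $G$ be a bi-block graph with $N=\sum_{k=1}^r(m_k+n_k)-r+1$ vertices and $r>1$ blocks $K_{m_k,n_k}$, and let $q$ satisfy $q\neq-1$, $q^2(m_k-1)(n_k-1)\neq1$ and $(q+1)^2(m_k-1)(n_k-1)\neq m_kn_k$ for all $k$. Let $\mathscr{D}$ be the $q$-distance matrix of $G$ and $\mathscr{L}$, $\mathbf{x}$ as defined below. Then $$\mathscr{D}\mathscr{L}+\mathbf{I}_N=\mathds{1}_N\mathbf{x}^T.$$
   Context: $q$ is a real or complex number (the paper calls it an indeterminate). For an integer $\alpha\ge1$, $[\alpha]=1+q+\cdots+q^{\alpha-1}$, $[0]=0$; the $q$-distance matrix $\mathscr{D}$ of a connected graph with vertices $v_1,\dots,v_N$ has $(i,j)$ entry $[d(v_i,v_j)]$, $d$ the shortest-path distance. A bi-block graph is a connected graph each of whose blocks (maximal connected subgraphs without a cut-vertex) is complete bipartite; its blocks are $K_{m_k,n_k}$ with a fixed bipartition $X_k\cup Y_k$, $|X_k|=m_k$, $|Y_k|=n_k$. Let $\hat d(v)$ be the number of blocks containing $v$, and $\Delta_k=q^2(m_k-1)(n_k-1)-1$. Define $\mathbf{x}(v)=\sum_{k:\,v\in X_k}\frac{q(n_k-1)-1}{(q+1)\Delta_k}+\sum_{k:\,v\in Y_k}\frac{q(m_k-1)-1}{(q+1)\Delta_k}-(\hat d(v)-1)$ and $\mathbf{y}(v)=\sum_{k:\,v\in X_k}\frac{n_k-1}{\Delta_k}+\sum_{k:\,v\in Y_k}\frac{m_k-1}{\Delta_k}-(\hat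 d(v)-1)$. Let $\mathbf{A}$ be the $N\times N$ matrix with $(u,v)$ entry $1/\Delta_k$ if $u\sim v$ and the edge $uv$ lies in block $K_{m_k,n_k}$, and $0$ otherwise. Let $\mathbf{B}$ be the $N\times N$ matrix with $(u,v)$ entry $\frac{n_k-1}{\Delta_k}$ if $u\neq v$ and $u,v\in X_k$ for some $k$, $\frac{m_k-1}{\Delta_k}$ if $u\neq v$ and $u,v\in Y_k$ for some $k$, and $0$ otherwise. Define $$\mathscr{L}=\frac{q}{q+1}\mathbf{A}-\frac{q^2}{q+1}\mathbf{B}-\frac{q^2}{q+1}\mathrm{diag}(\mathbf{y})+\frac{1}{q+1}\mathbf{I}_N.$$ $\mathds{1}_N$ is the all-ones vector. *)

theory Defs
  imports
    Complex_Main
    "Graph_Theory.Graph_Theory"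
    "Jordan_Normal_Form.Matrix"
begin

text \<open>
  A finite simple graph is a \<open>pair_graph\<close>: a finite, loopfree digraph without
  parallel arcs whose arc relation is symmetric.
\<close>

section \<open>Blocks and bi-block graphs\<close>

definition cut_vertex :: "('a, 'b) pre_digraph \<Rightarrow> 'a \<Rightarrow> bool" where
  "cut_vertex H c \<longleftrightarrow>
     c \<in> verts H \<and>
     (\<exists>u w. u \<noteq> c \<and> w \<noteq> c \<and> u \<rightarrow>\<^sup>*\<^bsub>H\<^esub> w \<and> \<not> u \<rightarrow>\<^sup>*\<^bsub>pre_digraph.del_vert H c\<^esub> w)"

text \<open>
  The conjunct \<open>graph H\<close> restricts the ambient notion of a subdigraph to
  undirected subgraphs, that is, to those with a symmetric arc relation.
\<close>

definition nonseparable :: "('a, 'b) pre_digraph \<Rightarrow> bool" where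
  "nonseparable H \<longleftrightarrow>
     graph H \<and> Digraph_Component.connected H \<and> \<not> (\<exists>c. cut_vertex H c)"

definition blocks :: "'a pair_pre_digraph \<Rightarrow> 'a pair_pre_digraph set" where
  "blocks G = {B. pre_digraph.max_subgraph (with_proj G) nonseparable (with_proj B)}"

text \<open>
  The library's \<open>K\<^bsub>m,n\<^esub>\<close> allows empty parts, hence the explicit bounds.
\<close>

definition bi_block_graph :: "'a pair_pre_digraph \<Rightarrow> bool" where
  "bi_block_graph G \<longleftrightarrow>
     pair_graph G \<and> Digraph_Component.connected (with_proj G) \<and>
     (\<forall>B \<in> blocks G. \<exists>m n. m \<ge> 1 \<and> n \<ge> 1 \<and> K\<^bsub>m,n\<^esub> (with_proj B))"

definition bipartition :: "'a pair_pre_digraph \<Rightarrow> 'a set \<Rightarrow> 'a set \<Rightarrow> bool" where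
  "bipartition B X Y \<longleftrightarrow>
     pverts B = X \<union> Y \<and> X \<inter> Y = {} \<and> X \<noteq> {} \<and> Y \<noteq> {} \<and>
     parcs B \<subseteq> X \<times> Y \<union> Y \<times> X"

definition num_blocks_at :: "'a pair_pre_digraph \<Rightarrow> 'a \<Rightarrow> nat" where
  "num_blocks_at G v = card {B \<in> blocks G. v \<in> pverts B}"


section \<open>The q-distance matrix\<close>

definition graph_dist :: "'a pair_pre_digraph \<Rightarrow> 'a \<Rightarrow> 'a \<Rightarrow> nat" where
  "graph_dist G u w = (LEAST l. \<exists>p. pre_digraph.apath (with_proj G) u p w \<and> length p = l)"

text \<open>
  The scalar \<open>q\<close> is real or complex; both types are instances of
  \<open>real_normed_field\<close>.
\<close>

definition q_int :: "'k::real_normed_field \<Rightarrow> nat \<Rightarrow> 'k" where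
  "q_int q \<alpha> = (\<Sum>i<\<alpha>. q ^ i)"

text \<open>
  In the matrices and vectors below, \<open>v 0, \<dots>, v (N - 1)\<close> enumerates the vertices.
\<close>

definition q_dist_mat ::
  "'k::real_normed_field \<Rightarrow> 'a pair_pre_digraph \<Rightarrow> nat \<Rightarrow> (nat \<Rightarrow> 'a) \<Rightarrow> 'k mat" where
  "q_dist_mat q G N v = mat N N (\<lambda>(i, j). q_int q (graph_dist G (v i) (v j)))"


section \<open>The vectors x, y and the matrix L\<close>

text \<open>
  Here \<open>B 1, \<dots>, B r\<close> are the blocks of \<open>G\<close>, and \<open>X k\<close>, \<open>Y k\<close> is the fixed
  bipartition of \<open>B k\<close>, with \<open>m\<^sub>k\<close> and \<open>n\<^sub>k\<close> the cardinalities of \<open>X k\<close> and \<open>Y k\<close>.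
\<close>

definition Delta :: "'k::real_normed_field \<Rightarrow> nat \<Rightarrow> nat \<Rightarrow> 'k" where
  "Delta q m n = q\<^sup>2 * (of_nat m - 1) * (of_nat n - 1) - 1"

definition x_entry ::
  "'k::real_normed_field \<Rightarrow> 'a pair_pre_digraph \<Rightarrow> nat \<Rightarrow> (nat \<Rightarrow> 'a set) \<Rightarrow> (nat \<Rightarrow> 'a set)
     \<Rightarrow> 'a \<Rightarrow> 'k" where
  "x_entry q G r X Y v =
     (\<Sum>k | k \<in> {1..r} \<and> v \<in> X k.
        (q * (of_nat (card (Y k)) - 1) - 1) / ((q + 1) * Delta q (card (X k)) (card (Y k))))
   + (\<Sum>k | k \<in> {1..r} \<and> v \<in> Y k.
        (q * (of_nat (card (X k)) - 1) - 1) / ((q + 1) * Delta q (card (X k)) (card (Y k))))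
   - (of_nat (num_blocks_at G v) - 1)"

definition y_entry ::
  "'k::real_normed_field \<Rightarrow> 'a pair_pre_digraph \<Rightarrow> nat \<Rightarrow> (nat \<Rightarrow> 'a set) \<Rightarrow> (nat \<Rightarrow> 'a set)
     \<Rightarrow> 'a \<Rightarrow> 'k" where
  "y_entry q G r X Y v =
     (\<Sum>k | k \<in> {1..r} \<and> v \<in> X k.
        (of_nat (card (Y k)) - 1) / Delta q (card (X k)) (card (Y k)))
   + (\<Sum>k | k \<in> {1..r} \<and> v \<in> Y k.
        (of_nat (card (X k)) - 1) / Delta q (card (X k)) (card (Y k)))
   - (of_nat (num_blocks_at G v) - 1)"

text \<open>
  The indices selected by \<open>THE\<close> below are well defined because two distinct blocks
  share at most one vertex.
\<close>

definition A_entry ::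
  "'k::real_normed_field \<Rightarrow> nat \<Rightarrow> (nat \<Rightarrow> 'a pair_pre_digraph) \<Rightarrow> (nat \<Rightarrow> 'a set)
     \<Rightarrow> (nat \<Rightarrow> 'a set) \<Rightarrow> 'a \<Rightarrow> 'a \<Rightarrow> 'k" where
  "A_entry q r B X Y u w =
     (if \<exists>k \<in> {1..r}. (u, w) \<in> parcs (B k)
      then let k = (THE k. k \<in> {1..r} \<and> (u, w) \<in> parcs (B k))
           in 1 / Delta q (card (X k)) (card (Y k))
      else 0)"

definition B_entry ::
  "'k::real_normed_field \<Rightarrow> nat \<Rightarrow> (nat \<Rightarrow> 'a set) \<Rightarrow> (nat \<Rightarrow> 'a set) \<Rightarrow> 'a \<Rightarrow> 'a \<Rightarrow> 'k" where
  "B_entry q r X Y u w =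
     (if u \<noteq> w \<and> (\<exists>k \<in> {1..r}. u \<in> X k \<and> w \<in> X k)
      then let k = (THE k. k \<in> {1..r} \<and> u \<in> X k \<and> w \<in> X k)
           in (of_nat (card (Y k)) - 1) / Delta q (card (X k)) (card (Y k))
      else if u \<noteq> w \<and> (\<exists>k \<in> {1..r}. u \<in> Y k \<and> w \<in> Y k)
      then let k = (THE k. k \<in> {1..r} \<and> u \<in> Y k \<and> w \<in> Y k)
           in (of_nat (card (X k)) - 1) / Delta q (card (X k)) (card (Y k))
      else 0)"

definition x_vec ::
  "'k::real_normed_field \<Rightarrow> 'a pair_pre_digraph \<Rightarrow> nat \<Rightarrow> (nat \<Rightarrow> 'a set) \<Rightarrow> (nat \<Rightarrow> 'a set)
     \<Rightarrow> nat \<Rightarrow> (nat \<Rightarrow> 'a) \<Rightarrow> 'k vec" where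
  "x_vec q G r X Y N v = vec N (\<lambda>i. x_entry q G r X Y (v i))"

definition L_mat ::
  "'k::real_normed_field \<Rightarrow> 'a pair_pre_digraph \<Rightarrow> nat \<Rightarrow> (nat \<Rightarrow> 'a pair_pre_digraph)
     \<Rightarrow> (nat \<Rightarrow> 'a set) \<Rightarrow> (nat \<Rightarrow> 'a set) \<Rightarrow> nat \<Rightarrow> (nat \<Rightarrow> 'a) \<Rightarrow> 'k mat" where
  "L_mat q G r B X Y N v =
     (q / (q + 1)) \<cdot>\<^sub>m mat N N (\<lambda>(i, j). A_entry q r B X Y (v i) (v j))
   - (q\<^sup>2 / (q + 1)) \<cdot>\<^sub>m mat N N (\<lambda>(i, j). B_entry q r X Y (v i) (v j))
   - (q\<^sup>2 / (q + 1)) \<cdot>\<^sub>m mat_diag N (\<lambda>i. y_entry q G r X Y (v i))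
   + (1 / (q + 1)) \<cdot>\<^sub>m 1\<^sub>m N"

text \<open>The outer product \<open>a b\<^sup>T\<close> of two column vectors.\<close>

definition outer_prod :: "'k::semiring_0 vec \<Rightarrow> 'k vec \<Rightarrow> 'k mat" where
  "outer_prod a b = mat_of_cols (dim_vec a) [a] * mat_of_row b"

end

theory Submission
  imports Defs
begin

text \<open>
  Up to the diagonal term \<open>(d\<^sub>w - 1) (q - 1)\<close>, where \<open>d\<^sub>w\<close> is the number of blocks at \<open>w\<close>,
  the matrix \<open>L\<close> is the sum over the blocks of the matrices \<open>L\<^sub>k\<close> that the construction assigns
  to a single block, and for one block \<open>D\<^sub>k L\<^sub>k + I = 1 x\<^sub>k\<^sup>T\<close> and \<open>1\<^sup>T L\<^sub>k = (1 - q) x\<^sub>k\<^sup>T\<close> are direct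
  computations. A vertex \<open>u\<close> sees a block through a unique gate \<open>a\<close>: every walk from \<open>u\<close> into
  the block enters it at \<open>a\<close>, since otherwise an ear could be attached to the block. So
  \<open>d(u,z) = d(u,a) + d(a,z)\<close> on the block, and \<open>[s + t] = [s] + q\<^sup>s [t]\<close> together with the two
  identities shows that the block contributes \<open>x\<^sub>k(w)\<close> to the entry \<open>(u,w)\<close> of \<open>D L\<close>, minus
  \<open>q\<close> to the power \<open>d(u,w)\<close> if its gate is \<open>w\<close>. If \<open>u \<noteq> w\<close>, then exactly one block at \<open>w\<close>, the
  one pointing towards \<open>u\<close>, has a gate other than \<open>w\<close>; if \<open>u = w\<close> there is none. Hence the
  powers of \<open>q\<close> cancel against the diagonal term.
\<close>

section \<open>Biconnected relations and distances\<close>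

definition avoiding :: "('a \<times> 'a) set \<Rightarrow> 'a set \<Rightarrow> ('a \<times> 'a) set" where
  "avoiding F C = {(x, y) \<in> F. x \<notin> C \<and> y \<notin> C}"

text \<open>
  The set \<open>C\<close> is empty or a singleton, so that connectedness and the absence of cut vertices
  are one condition.
\<close>

definition biconnected :: "'a set \<Rightarrow> ('a \<times> 'a) set \<Rightarrow> bool" where
  "biconnected W F \<longleftrightarrow> W \<noteq> {} \<and> F \<subseteq> W \<times> W \<and> sym F \<and>
     (\<forall>C c. C \<subseteq> {c} \<longrightarrow> (\<forall>u\<in>W - C. \<forall>w\<in>W - C. (u, w) \<in> (avoiding F C)\<^sup>*))"

text \<open>Distance measured along walks rather than paths: the exponents of relational powers add
  when walks are composed. For unreachable pairs the value is the \<open>LEAST\<close> of an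
  unsatisfiable predicate.\<close>

definition rdist :: "('a \<times> 'a) set \<Rightarrow> 'a \<Rightarrow> 'a \<Rightarrow> nat" where
  "rdist E u w = (LEAST l. (u, w) \<in> E ^^ l)"

section \<open>Connectivity after the deletion of a vertex\<close>

lemma avoiding_mono: "F \<subseteq> F' \<Longrightarrow> avoiding F C \<subseteq> avoiding F' C"
  by (auto simp: avoiding_def)

lemma avoiding_empty [simp]: "avoiding F {} = F"
  by (auto simp: avoiding_def)

lemma sym_avoiding: "sym F \<Longrightarrow> sym (avoiding F C)"
  by (auto simp: avoiding_def sym_def)

lemma rtrancl_avoiding_notin: "(x, y) \<in> (avoiding F C)\<^sup>* \<Longrightarrow> x \<notin> C \<Longrightarrow> y \<notin> C"
  by (induction rule: rtrancl_induct) (auto simp: avoiding_def)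

lemma rtrancl_sym: "sym R \<Longrightarrow> (x, y) \<in> R\<^sup>* \<Longrightarrow> (y, x) \<in> R\<^sup>*"
  by (meson sym_rtrancl symD)

lemma biconnectedD:
  "biconnected W F \<Longrightarrow> C \<subseteq> {c} \<Longrightarrow> u \<in> W - C \<Longrightarrow> w \<in> W - C \<Longrightarrow> (u, w) \<in> (avoiding F C)\<^sup>*"
  unfolding biconnected_def by meson

text \<open>Deleting one vertex leaves at least one of the shared vertices \<open>x\<close>,
  \<open>y\<close>, and every remaining vertex of either side still reaches it.\<close>

lemma biconnected_union:
  assumes "biconnected W F" "biconnected W' F'" "x \<in> W \<inter> W'" "y \<in> W \<inter> W'" "x \<noteq> y"
  shows "biconnected (W \<union> W') (F \<union> F')"
  unfolding biconnected_def
proof (intro conjI allI impI ballI)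
  have "F \<subseteq> W \<times> W" "F' \<subseteq> W' \<times> W'" "sym F" "sym F'"
    using assms(1,2) unfolding biconnected_def by simp_all
  then show "F \<union> F' \<subseteq> (W \<union> W') \<times> (W \<union> W')" "sym (F \<union> F')" by (blast, simp add: sym_Un)
  show "W \<union> W' \<noteq> {}" using assms(3) by blast
  fix C c u w assume C: "C \<subseteq> {c}" and u: "u \<in> W \<union> W' - C" and w: "w \<in> W \<union> W' - C"
  obtain z where z: "z \<in> W" "z \<in> W'" "z \<notin> C" using C assms(3-5) by blast
  have *: "(p, z) \<in> (avoiding (F \<union> F') C)\<^sup>*" "(z, p) \<in> (avoiding (F \<union> F') C)\<^sup>*"
    if "p \<in> W \<union> W' - C" for p
  proof -
    have "(avoiding F C)\<^sup>* \<subseteq> (avoiding (F \<union> F') C)\<^sup>*" "(avoiding F' C)\<^sup>* \<subseteq> (avoiding (F \<union> F') C)\<^sup>*"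
      by (simp_all add: avoiding_mono rtrancl_mono)
    with that z biconnectedD[OF assms(1) C] biconnectedD[OF assms(2) C]
    show "(p, z) \<in> (avoiding (F \<union> F') C)\<^sup>*" "(z, p) \<in> (avoiding (F \<union> F') C)\<^sup>*" by blast+
  qed
  show "(u, w) \<in> (avoiding (F \<union> F') C)\<^sup>*" using * u w by (meson rtrancl_trans)
qed

lemma biconnected_edge:
  assumes "x \<noteq> y"
  shows "biconnected {x, y} {(x, y), (y, x)}"
  unfolding biconnected_def
proof (intro conjI allI impI ballI)
  fix C u w assume u: "u \<in> {x, y} - C" and w: "w \<in> {x, y} - C"
  then have "u = w \<or> (u, w) \<in> avoiding {(x, y), (y, x)} C" by (auto simp: avoiding_def)
  then show "(u, w) \<in> (avoiding {(x, y), (y, x)} C)\<^sup>*" by blast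
qed (auto simp: sym_def)

lemma path_reaches_last:
  assumes "successively (\<lambda>x y. (x, y) \<in> F) p" "set p \<inter> C = {}" "z \<in> set p"
  shows "(z, last p) \<in> (avoiding F C)\<^sup>*"
  using assms
proof (induction p arbitrary: z)
  case (Cons x p)
  show ?case
  proof (cases "p = []")
    case False
    then have "(x, hd p) \<in> avoiding F C"
      using Cons.prems hd_in_set[OF False]
      by (auto simp del: hd_in_set simp: avoiding_def successively_Cons)
    moreover have "(z', last p) \<in> (avoiding F C)\<^sup>*" if "z' \<in> set p" for z'
      using Cons.IH[OF _ _ that] Cons.prems False by (simp add: successively_Cons)
    ultimately show ?thesis
      using Cons.prems(3) False hd_in_set[OF False]
      by (auto intro: converse_rtrancl_into_rtrancl)
  qed (use Cons.prems in auto)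
qed simp

text \<open>The deleted vertex occurs at most once on a path without repetitions, so it cannot cut
  \<open>z\<close> off from both ends.\<close>

lemma path_avoiding_ends:
  assumes "distinct p" "successively (\<lambda>x y. (x, y) \<in> F) p" "sym F" "C \<subseteq> {c}" "z \<in> set p" "z \<notin> C"
  shows "(z, hd p) \<in> (avoiding F C)\<^sup>* \<or> (z, last p) \<in> (avoiding F C)\<^sup>*"
  using assms(1,2,5,6)
proof (induction p arbitrary: z)
  case Nil then show ?case by simp
next
  case (Cons x p)
  show ?case
  proof (cases "z = x \<or> p = []")
    case True then show ?thesis using Cons.prems by auto
  next
    case False
    then have zp: "z \<in> set p" and ne: "p \<noteq> []" using Cons.prems by auto
    have x: "(x, hd p) \<in> F" and sp: "successively (\<lambda>x y. (x, y) \<in> F) p"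
      using Cons.prems(2) ne by (auto simp: successively_Cons)
    have IH: "(z, hd p) \<in> (avoiding F C)\<^sup>* \<or> (z, last p) \<in> (avoiding F C)\<^sup>*"
      using Cons.IH[OF _ sp zp] Cons.prems by auto
    show ?thesis
    proof (cases "x \<in> C")
      case True
      \<comment> \<open>The head is the deleted vertex; by distinctness the rest of the path avoids
        it, and the way to the last vertex is free.\<close>
      then have "set p \<inter> C = {}" using assms(4) Cons.prems(1) by auto
      then have "(z, last p) \<in> (avoiding F C)\<^sup>*" by (rule path_reaches_last[OF sp _ zp])
      then show ?thesis using ne by simp
    next
      case False
      have "(z, x) \<in> (avoiding F C)\<^sup>*" if "(z, hd p) \<in> (avoiding F C)\<^sup>*"
      proof -
        have "hd p \<notin> C" using rtrancl_avoiding_notin[OF that] Cons.prems by simp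
        then have "(hd p, x) \<in> avoiding F C" using x False assms(3)
          by (auto simp: avoiding_def sym_def)
        with that show ?thesis by simp
      qed
      then show ?thesis using IH ne by auto
    qed
  qed
qed

text \<open>Turns a walk outside \<open>W\<close> into a path, the form in which an ear is attached.
  The start needs its own hypothesis because the empty walk also exists at points of
  \<open>W\<close>.\<close>

lemma rtrancl_avoiding_path:
  assumes "(s, t) \<in> (avoiding E W)\<^sup>*" "s \<notin> W"
  shows "\<exists>p. p \<noteq> [] \<and> distinct p \<and> hd p = s \<and> last p = t \<and> successively (\<lambda>x y. (x, y) \<in> E) p
           \<and> set p \<inter> W = {}"
  using assms
proof (induction rule: rtrancl_induct)
  case base
  then show ?case by (intro exI[of _ "[s]"]) auto
next
  case (step y z)
  then obtain p where p: "p \<noteq> []" "distinct p" "hd p = s" "last p = y"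
    "successively (\<lambda>x y. (x, y) \<in> E) p" "set p \<inter> W = {}" by auto
  show ?case
  proof (cases "z \<in> set p")
    case True
    then obtain p1 p2 where e: "p = p1 @ z # p2" by (meson split_list)
    \<comment> \<open>The walk returns to the path at \<open>z\<close>: the loop is removed by
      cutting the path there.\<close>
    have "successively (\<lambda>x y. (x, y) \<in> E) ((p1 @ [z]) @ p2)" using p(5) e by simp
    then have "successively (\<lambda>x y. (x, y) \<in> E) (p1 @ [z])"
      unfolding successively_append_iff by blast
    then show ?thesis using p e
      by (intro exI[of _ "p1 @ [z]"]) (auto simp: hd_append)
  next
    case False
    then show ?thesis using p step(2)
      by (intro exI[of _ "p @ [z]"]) (auto simp: successively_append_iff avoiding_def)
  qed
qed

text \<open>After the deletion of a vertex, an ear vertex still reaches one end of the ear, hence a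
  surviving vertex of \<open>W\<close>, and \<open>W\<close> itself stays connected. All arcs of
  \<open>E\<close> on the enlarged vertex set are taken, which covers both \<open>F\<close> and the
  ear.\<close>

lemma biconnected_ear:
  assumes bi: "biconnected W F" and "F \<subseteq> E" and symE: "sym E"
    and ab: "a \<in> W" "b \<in> W" "a \<noteq> b"
    and p: "distinct p" "successively (\<lambda>x y. (x, y) \<in> E) p" "set p \<inter> W = {}" "p \<noteq> []"
    and e: "(a, hd p) \<in> E" "(last p, b) \<in> E"
  shows "biconnected (W \<union> set p) (E \<inter> (W \<union> set p) \<times> (W \<union> set p))" (is "biconnected ?W ?F")
  unfolding biconnected_def
proof (intro conjI allI impI ballI)
  show "?W \<noteq> {}" using ab by blast
  show "?F \<subseteq> ?W \<times> ?W" by blast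
  show symF: "sym ?F" using symE by (auto simp: sym_def)
  fix C c u w assume C: "C \<subseteq> {c}" and u: "u \<in> ?W - C" and w: "w \<in> ?W - C"
  let ?p = "a # p @ [b]"
  have dp: "distinct ?p" using p ab by auto
  have "successively (\<lambda>x y. (x, y) \<in> E) ?p"
    using p e by (auto simp: successively_Cons successively_append_iff)
  then have sp: "successively (\<lambda>x y. (x, y) \<in> ?F) ?p"
    by (rule successively_mono) (use ab in auto)
  have FF: "F \<subseteq> ?F" using assms(2) bi unfolding biconnected_def by (elim conjE) blast
  then have mono: "(avoiding F C)\<^sup>* \<subseteq> (avoiding ?F C)\<^sup>*"
    by (simp add: avoiding_mono rtrancl_mono)
  have sy: "sym (avoiding ?F C)" using symF by (rule sym_avoiding)
  have toW: "\<exists>z\<in>W - C. (v, z) \<in> (avoiding ?F C)\<^sup>*" if v: "v \<in> ?W - C" for v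
  proof (cases "v \<in> W")
    case True then show ?thesis using v by auto
  next
    case False
    then have "v \<in> set ?p" using v by auto
    from path_avoiding_ends[OF dp sp symF C this] v
    have "(v, a) \<in> (avoiding ?F C)\<^sup>* \<or> (v, b) \<in> (avoiding ?F C)\<^sup>*" by simp
    \<comment> \<open>The end that is reached is not the deleted vertex, since walks avoiding
      \<open>C\<close> from outside \<open>C\<close> never meet it.\<close>
    then show ?thesis using rtrancl_avoiding_notin v ab by (metis DiffD2 DiffI)
  qed
  obtain z1 z2 where z: "z1 \<in> W - C" "z2 \<in> W - C" "(u, z1) \<in> (avoiding ?F C)\<^sup>*"
    "(w, z2) \<in> (avoiding ?F C)\<^sup>*" using toW u w by meson
  have "(z1, z2) \<in> (avoiding ?F C)\<^sup>*" using biconnectedD[OF bi C z(1,2)] mono by blast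
  then show "(u, w) \<in> (avoiding ?F C)\<^sup>*"
    using z rtrancl_sym[OF sy z(4)] by (meson rtrancl_trans)
qed

section \<open>Walks that enter a set or pass through a vertex\<close>

lemma first_entry:
  assumes "(u, z) \<in> R\<^sup>*" "u \<notin> W" "z \<in> W"
  obtains s z' where "(u, s) \<in> (avoiding R W)\<^sup>*" "(s, z') \<in> R" "z' \<in> W" "s \<notin> W"
proof -
  \<comment> \<open>Induction invariant: the walk has either stayed outside \<open>W\<close> so far,
    or its first entry has already been recorded.\<close>
  have "z \<notin> W \<and> (u, z) \<in> (avoiding R W)\<^sup>* \<or>
      (\<exists>s z'. (u, s) \<in> (avoiding R W)\<^sup>* \<and> (s, z') \<in> R \<and> z' \<in> W \<and> s \<notin> W)"
    using assms(1,2)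
  proof (induction rule: rtrancl_induct)
    case (step y z)
    have "(y, z) \<in> avoiding R W" if "y \<notin> W" "z \<notin> W"
      using that step(2) by (simp add: avoiding_def)
    then show ?case using step by (meson rtrancl_into_rtrancl)
  qed auto
  then show thesis using assms that by blast
qed

text \<open>Whichever of \<open>a\<close> and \<open>w\<close> the walk meets first is reached
  without the other. If \<open>a\<close> separates \<open>u\<close> from \<open>w\<close>, only the
  first alternative remains.\<close>

lemma rtrancl_first_of_two:
  assumes "(u, a) \<in> R\<^sup>*" "a \<noteq> w"
  shows "(u, a) \<in> (avoiding R {w})\<^sup>* \<or> (u, w) \<in> (avoiding R {a})\<^sup>*"
  using assms(1)
proof (induction rule: converse_rtrancl_induct)
  case (step u y)
  show ?case
  proof (cases "u = a \<or> u = w")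
    case False
    consider "y = w" | "y = a" | "y \<noteq> w" "y \<noteq> a" by blast
    then show ?thesis
    proof cases
      case 1
      then have "(u, w) \<in> avoiding R {a}" using step False assms by (auto simp: avoiding_def)
      then show ?thesis by blast
    next
      case 2
      then have "(u, a) \<in> avoiding R {w}" using step False assms by (auto simp: avoiding_def)
      then show ?thesis by blast
    next
      case 3
      then have "(u, y) \<in> avoiding R {w}" "(u, y) \<in> avoiding R {a}"
        using step False assms by (auto simp: avoiding_def)
      then show ?thesis using step by (meson converse_rtrancl_into_rtrancl)
    qed
  qed auto
qed auto

text \<open>A walk that cannot avoid \<open>a\<close> is split at a visit to \<open>a\<close>, and
  the two lengths add up to the length of the walk.\<close>

lemma relpow_through:
  assumes "(u, z) \<in> R ^^ l" "(u, z) \<notin> (avoiding R {a})\<^sup>*"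
  shows "\<exists>i\<le>l. (u, a) \<in> R ^^ i \<and> (a, z) \<in> R ^^ (l - i)"
  using assms
proof (induction l arbitrary: u)
  case (Suc l)
  obtain y where y: "(u, y) \<in> R" "(y, z) \<in> R ^^ l" using Suc.prems(1) by (meson relpow_Suc_D2)
  show ?case
  proof (cases "u = a")
    case True
    then show ?thesis using Suc.prems(1) by (intro exI[of _ 0]) auto
  next
    case ua: False
    show ?thesis
    proof (cases "y = a")
      case True
      then show ?thesis using y by (intro exI[of _ 1]) auto
    next
      case False
      then have "(u, y) \<in> avoiding R {a}" using ua y by (auto simp: avoiding_def)
      then have "(y, z) \<notin> (avoiding R {a})\<^sup>*"
        using Suc.prems(2) by (meson converse_rtrancl_into_rtrancl)
      from Suc.IH[OF y(2) this] obtain i where i: "i \<le> l" "(y, a) \<in> R ^^ i" "(a, z) \<in> R ^^ (l - i)"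
        by blast
      then show ?thesis using relpow_Suc_I2[OF y(1) i(2)]
        by (intro exI[of _ "Suc i"]) auto
    qed
  qed
qed auto

section \<open>Distances as least exponents of relational powers\<close>

lemma rdist_le: "(u, w) \<in> E ^^ l \<Longrightarrow> rdist E u w \<le> l"
  unfolding rdist_def by (rule Least_le)

lemma rdist_relpow: "(u, w) \<in> E\<^sup>* \<Longrightarrow> (u, w) \<in> E ^^ rdist E u w"
  unfolding rdist_def by (metis LeastI_ex rtrancl_imp_relpow)

lemma rdist_refl [simp]: "rdist E u u = 0"
  using rdist_le[of u u 0 E] by simp

lemma rdist_edge:
  assumes "(u, w) \<in> E" "u \<noteq> w"
  shows "rdist E u w = 1"
proof -
  have "rdist E u w \<le> 1" using assms rdist_le[of u w 1 E] by simp
  moreover have "(u, w) \<in> E ^^ rdist E u w" using assms(1) by (intro rdist_relpow) blast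
  then have "rdist E u w \<noteq> 0" using assms(2) by (metis pair_in_Id_conv relpow.simps(1))
  ultimately show ?thesis by linarith
qed

lemma rdist_two:
  assumes "(u, x) \<in> E" "(x, w) \<in> E" "u \<noteq> w" "(u, w) \<notin> E"
  shows "rdist E u w = 2"
proof -
  have 2: "(u, w) \<in> E ^^ 2" using assms by (auto simp: numeral_2_eq_2)
  then have "rdist E u w \<le> 2" by (rule rdist_le)
  moreover have "(u, w) \<in> E ^^ rdist E u w" using 2 by (meson rdist_relpow relpow_imp_rtrancl)
  then have "rdist E u w \<noteq> 0" "rdist E u w \<noteq> 1"
    using assms by (metis pair_in_Id_conv relpow.simps(1), metis relpow_1)
  ultimately show ?thesis by linarith
qed

text \<open>One inequality is the triangle inequality; for the other, a shortest walk from
  \<open>u\<close> to \<open>z\<close> is split at \<open>a\<close>.\<close>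

lemma rdist_through:
  assumes "(u, a) \<in> E\<^sup>*" "(a, z) \<in> E\<^sup>*" "(u, z) \<notin> (avoiding E {a})\<^sup>*"
  shows "rdist E u z = rdist E u a + rdist E a z"
proof (rule antisym)
  show "rdist E u z \<le> rdist E u a + rdist E a z"
    by (rule rdist_le) (use assms rdist_relpow in \<open>fastforce simp: relpow_add\<close>)
  have "(u, z) \<in> E ^^ rdist E u z" using assms by (meson rdist_relpow rtrancl_trans)
  from relpow_through[OF this assms(3)] obtain i where
    "i \<le> rdist E u z" "(u, a) \<in> E ^^ i" "(a, z) \<in> E ^^ (rdist E u z - i)" by blast
  then show "rdist E u a + rdist E a z \<le> rdist E u z"
    using rdist_le[of u a i E] rdist_le[of a z "rdist E u z - i" E] by linarith
qed

section \<open>Blocks and their gates\<close>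

text \<open>A graph is reduced to a vertex set with a symmetric relation, so that subgraphs are
  plain pairs of sets. The next section translates from \<open>pair_graph\<close>.\<close>

locale connected_relation =
  fixes V :: "'a set" and E :: "('a \<times> 'a) set"
  assumes finite_V: "finite V" and E_sub: "E \<subseteq> V \<times> V" and sym_E: "sym E" and irrefl_E: "irrefl E"
    and conn: "\<And>u w. u \<in> V \<Longrightarrow> w \<in> V \<Longrightarrow> (u, w) \<in> E\<^sup>*"
begin

text \<open>Maximality ranges over all pairs of a vertex set and an arc set, as for
  \<open>max_subgraph\<close>; that a block is an induced subgraph is derived in
  \<open>block_induced\<close>.\<close>

definition block :: "'a set \<Rightarrow> ('a \<times> 'a) set \<Rightarrow> bool" where
  "block W F \<longleftrightarrow> W \<subseteq> V \<and> F \<subseteq> E \<and> biconnected W F \<and>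
     (\<forall>W' F'. W' \<subseteq> V \<and> F' \<subseteq> E \<and> biconnected W' F' \<and> W \<subseteq> W' \<and> F \<subseteq> F' \<longrightarrow> W' = W \<and> F' = F)"

lemma blockD:
  assumes "block W F"
  shows "W \<subseteq> V" "F \<subseteq> E" "biconnected W F" "F \<subseteq> W \<times> W" "W \<noteq> {}"
  using assms unfolding block_def biconnected_def by simp_all

lemma block_maximal:
  assumes "block W F" "biconnected W' F'" "W' \<subseteq> V" "F' \<subseteq> E" "W \<subseteq> W'" "F \<subseteq> F'"
  shows "W' = W \<and> F' = F"
  using assms unfolding block_def by metis

text \<open>The union of the two is again biconnected, so maximality of the block leaves nothing to
  add.\<close>

lemma block_absorb:
  assumes "block W F" "biconnected W' F'" "W' \<subseteq> V" "F' \<subseteq> E" "x \<in> W \<inter> W'" "y \<in> W \<inter> W'" "x \<noteq> y"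
  shows "W' \<subseteq> W" "F' \<subseteq> F"
proof -
  have "biconnected (W \<union> W') (F \<union> F')"
    using biconnected_union[OF blockD(3)[OF assms(1)] assms(2,5-7)] .
  then have "W \<union> W' = W \<and> F \<union> F' = F"
    using blockD(1,2)[OF assms(1)] assms(3,4) by (intro block_maximal[OF assms(1)]) auto
  then show "W' \<subseteq> W" "F' \<subseteq> F" by blast+
qed

lemma block_eq:
  assumes "block W F" "block W' F'" "x \<in> W \<inter> W'" "y \<in> W \<inter> W'" "x \<noteq> y"
  shows "W = W'" "F = F'"
  using block_absorb[OF assms(1) blockD(3,1,2)[OF assms(2)], of x y]
    block_absorb[OF assms(2) blockD(3,1,2)[OF assms(1)], of x y] assms(3-5) by blast+

text \<open>A single edge is biconnected and shares both its ends with the block, which therefore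
  absorbs it.\<close>

lemma block_induced:
  assumes "block W F" "x \<in> W" "y \<in> W" "(x, y) \<in> E"
  shows "(x, y) \<in> F"
proof -
  have xy: "x \<noteq> y" using assms(4) irrefl_E by (auto simp: irrefl_def)
  have "(y, x) \<in> E" using sym_E assms(4) by (rule symD)
  then have "{(x, y), (y, x)} \<subseteq> F"
    using assms E_sub xy by (intro block_absorb(2)[OF assms(1) biconnected_edge, of x y x y]) auto
  then show ?thesis by blast
qed

lemma edge_in_block:
  assumes "(x, y) \<in> E"
  obtains W F where "block W F" "(x, y) \<in> F"
proof -
  have xy: "x \<noteq> y" using assms irrefl_E by (auto simp: irrefl_def)
  let ?S = "{(W, F). W \<subseteq> V \<and> F \<subseteq> E \<and> biconnected W F \<and> (x, y) \<in> F}"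
  have finE: "finite E" using finite_V E_sub by (meson finite_SigmaI finite_subset)
  have "?S \<subseteq> Pow V \<times> Pow E" by blast
  then have fin: "finite ?S" using finE finite_V by (meson finite_Pow_iff finite_SigmaI finite_subset)
  have ne: "({x, y}, {(x, y), (y, x)}) \<in> ?S"
    using assms E_sub symD[OF sym_E assms] biconnected_edge[OF xy] by auto
  \<comment> \<open>Counting vertices and arcs together makes the size grow strictly under any
    proper extension, so a largest element of the finite set \<open>?S\<close> is maximal.\<close>
  let ?size = "\<lambda>(W, F). card W + card F"
  have "finite (?size ` ?S)" "?size ` ?S \<noteq> {}" using fin ne by blast+
  then have "Max (?size ` ?S) \<in> ?size ` ?S" by (rule Max_in)
  then obtain W F where WF: "(W, F) \<in> ?S" and "card W + card F = Max (?size ` ?S)" by auto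
  then have mx: "card W' + card F' \<le> card W + card F" if "(W', F') \<in> ?S" for W' F'
    using Max_ge[OF \<open>finite (?size ` ?S)\<close>, of "card W' + card F'"] that by force
  have "block W F" unfolding block_def
  proof (intro conjI allI impI)
    show "W \<subseteq> V" "F \<subseteq> E" "biconnected W F" using WF by auto
    fix W' F' assume a: "W' \<subseteq> V \<and> F' \<subseteq> E \<and> biconnected W' F' \<and> W \<subseteq> W' \<and> F \<subseteq> F'"
    then have "(W', F') \<in> ?S" using WF by blast
    then have le: "card W' + card F' \<le> card W + card F" by (rule mx)
    have fin': "finite W'" "finite F'" using a finite_V finE finite_subset by blast+
    then have "card W \<le> card W'" "card F \<le> card F'" using a card_mono by blast+
    then show "W' = W" "F' = F"
      using le a fin' card_subset_eq[of W' W] card_subset_eq[of F' F] by auto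
  qed
  then show thesis using that WF by blast
qed

text \<open>A vertex of the block is its own gate, because no arc leaves it once it is deleted. For
  a vertex outside, the gate is the entry point of an arbitrary walk into the block.\<close>

lemma block_gate:
  assumes bl: "block W F" and u: "u \<in> V"
  shows "\<exists>a\<in>W. \<forall>z\<in>W - {a}. (u, z) \<notin> (avoiding E {a})\<^sup>*"
proof (cases "u \<in> W")
  case True
  have "(u, z) \<notin> (avoiding E {u})\<^sup>*" if "z \<noteq> u" for z
  proof
    assume "(u, z) \<in> (avoiding E {u})\<^sup>*"
    then show False using that by (cases rule: converse_rtranclE) (auto simp: avoiding_def)
  qed
  then show ?thesis using True by blast
next
  case False
  have WV: "W \<subseteq> V" "F \<subseteq> E" and bi: "biconnected W F" and "W \<noteq> {}"
    using blockD[OF bl] by blast+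
  then obtain z0 where z0: "z0 \<in> W" by blast
  obtain s a where s: "(u, s) \<in> (avoiding E W)\<^sup>*" "(s, a) \<in> E" "a \<in> W" "s \<notin> W"
    using first_entry[of u z0 E W] conn False z0 u WV by blast
  \<comment> \<open>A second entry point \<open>b\<close> would give a path from \<open>a\<close> to \<open>b\<close> outside the block, an ear that
    contradicts maximality.\<close>
  have "(u, z) \<notin> (avoiding E {a})\<^sup>*" if z: "z \<in> W - {a}" for z
  proof
    assume "(u, z) \<in> (avoiding E {a})\<^sup>*"
    then obtain t b where t: "(u, t) \<in> (avoiding (avoiding E {a}) W)\<^sup>*" "(t, b) \<in> avoiding E {a}"
      "b \<in> W" "t \<notin> W"
      using first_entry[of u z "avoiding E {a}" W] False z by blast
    have "avoiding (avoiding E {a}) W \<subseteq> avoiding E W" by (auto simp: avoiding_def)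
    then have ut: "(u, t) \<in> (avoiding E W)\<^sup>*" using t(1) rtrancl_mono by blast
    have tb: "(t, b) \<in> E" "a \<noteq> b" using t(2) by (auto simp: avoiding_def)
    \<comment> \<open>Back from \<open>s\<close> to \<open>u\<close> and on to \<open>t\<close>,
      entirely outside the block.\<close>
    have "(s, t) \<in> (avoiding E W)\<^sup>*"
      using rtrancl_sym[OF sym_avoiding[OF sym_E] s(1)] ut by (rule rtrancl_trans)
    from rtrancl_avoiding_path[OF this s(4)] obtain p where
      p: "p \<noteq> []" "distinct p" "hd p = s" "last p = t" "successively (\<lambda>x y. (x, y) \<in> E) p"
        "set p \<inter> W = {}" by blast
    let ?W = "W \<union> set p"
    have "biconnected ?W (E \<inter> ?W \<times> ?W)"
      using biconnected_ear[OF bi WV(2) sym_E s(3) t(3) tb(2) p(2,5,6,1)] p(3,4) tb(1)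
        symD[OF sym_E s(2)] by blast
    \<comment> \<open>Every vertex of \<open>p\<close> is the source of an arc: to its successor, or
      to \<open>b\<close> for the last one.\<close>
    moreover have "set p \<subseteq> V"
    proof
      fix x assume "x \<in> set p"
      then obtain p1 p2 where e: "p = p1 @ x # p2" by (meson split_list)
      show "x \<in> V"
      proof (cases p2)
        case Nil
        then show ?thesis using e p(4) tb E_sub by auto
      next
        case (Cons y ys)
        then have "(x, y) \<in> E" using p(5) e by (auto simp: successively_append_iff)
        then show ?thesis using E_sub by auto
      qed
    qed
    moreover have "F \<subseteq> E \<inter> ?W \<times> ?W" using WV blockD(4)[OF bl] by blast
    ultimately have "?W = W" using block_maximal[OF bl, of ?W "E \<inter> ?W \<times> ?W"] WV by blast
    then show False using p(1,6) by (cases p) auto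
  qed
  then show ?thesis using s by blast
qed

text \<open>Two such blocks would let \<open>a2\<close> reach \<open>a1\<close> around
  \<open>w\<close>, although the blocks meet only in \<open>w\<close>. The contradiction comes from
  the gate of the first block as seen from \<open>a2\<close>.\<close>

lemma block_gate_unique:
  assumes "block W1 F1" "block W2 F2" "w \<in> W1 \<inter> W2" "W1 \<noteq> W2" "u \<in> V"
    and a1: "a1 \<in> W1" "a1 \<noteq> w" "(u, w) \<notin> (avoiding E {a1})\<^sup>*"
    and a2: "a2 \<in> W2" "a2 \<noteq> w" "(u, w) \<notin> (avoiding E {a2})\<^sup>*"
  shows False
proof -
  have V: "W1 \<subseteq> V" "W2 \<subseteq> V" "F2 \<subseteq> E" "biconnected W2 F2" using blockD[OF assms(1)] blockD[OF assms(2)] by blast+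
  have "(u, a1) \<in> (avoiding E {w})\<^sup>*" "(u, a2) \<in> (avoiding E {w})\<^sup>*"
    using rtrancl_first_of_two[of u a1 E w] rtrancl_first_of_two[of u a2 E w] conn V a1 a2 assms(5)
    by blast+
  then have r: "(a2, a1) \<in> (avoiding E {w})\<^sup>*"
    using rtrancl_sym[OF sym_avoiding[OF sym_E]] by (meson rtrancl_trans)
  obtain g where g: "g \<in> W1" "\<forall>z\<in>W1 - {g}. (a2, z) \<notin> (avoiding E {g})\<^sup>*"
    using block_gate[OF assms(1), of a2] V a2 by blast
  show False
  proof (cases "g = w")
    case True
    then show ?thesis using g r a1 by blast
  next
    case False
    \<comment> \<open>A gate other than \<open>w\<close> lies outside the second block, which then
      joins \<open>a2\<close> to \<open>w\<close> without meeting it, so it would be no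
      gate.\<close>
    then have "g \<notin> W2" using block_eq(1)[OF assms(1,2), of g w] assms g by blast
    then have "(a2, w) \<in> (avoiding F2 {g})\<^sup>*"
      using biconnectedD[OF V(4), of "{g}" g a2 w] a2 assms by blast
    moreover have "(avoiding F2 {g})\<^sup>* \<subseteq> (avoiding E {g})\<^sup>*"
      using V by (simp add: avoiding_mono rtrancl_mono)
    ultimately show ?thesis using g False assms(3) by blast
  qed
qed

text \<open>The block is the one of the last edge of a walk that stops on reaching \<open>w\<close>.
  As \<open>y\<close> is reachable without \<open>w\<close>, the vertex \<open>w\<close> cannot be
  the gate of this block.\<close>

lemma block_gate_exists:
  assumes "u \<in> V" "w \<in> V" "u \<noteq> w"
  obtains W F y where "block W F" "w \<in> W" "y \<in> W" "y \<noteq> w" "(u, y) \<in> (avoiding E {w})\<^sup>*"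
proof -
  obtain y where y: "(u, y) \<in> (avoiding E {w})\<^sup>*" "(y, w) \<in> E" "y \<noteq> w"
    using first_entry[of u w E "{w}"] conn assms by blast
  from edge_in_block[OF y(2)] obtain W F where W: "block W F" "(y, w) \<in> F" .
  then have "y \<in> W" "w \<in> W" using blockD(4)[OF W(1)] by blast+
  then show thesis using that W y by blast
qed

end

section \<open>Nonseparable subgraphs as biconnected relations\<close>

lemma rtrancl_on_iff_rtrancl:
  assumes "R \<subseteq> A \<times> A"
  shows "(x, y) \<in> rtrancl_on A R \<longleftrightarrow> x \<in> A \<and> (x, y) \<in> R\<^sup>*"
proof
  assume "(x, y) \<in> rtrancl_on A R"
  then show "x \<in> A \<and> (x, y) \<in> R\<^sup>*"
    by (induction rule: rtrancl_on.induct) (auto intro: rtrancl_into_rtrancl)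
next
  assume "x \<in> A \<and> (x, y) \<in> R\<^sup>*"
  then have "(x, y) \<in> R\<^sup>*" "x \<in> A" by auto
  then show "(x, y) \<in> rtrancl_on A R"
    by (induction rule: rtrancl_induct)
      (use assms in \<open>auto intro: rtrancl_on_into_rtrancl_on\<close>)
qed

context pair_graph
begin

lemma parcs_subset: "parcs G \<subseteq> pverts G \<times> pverts G"
  using arc_fst_in_verts arc_snd_in_verts by fastforce

lemma sym_parcs: "sym (parcs G)"
  using pair_sym_arcs by (simp add: symmetric_def)

lemma irrefl_parcs: "irrefl (parcs G)"
  using pair_no_loops by (fastforce simp: irrefl_def)

lemma reachable_iff_rtrancl:
  "u \<rightarrow>\<^sup>*\<^bsub>with_proj G\<^esub> w \<longleftrightarrow> u \<in> pverts G \<and> (u, w) \<in> (parcs G)\<^sup>*"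
  using rtrancl_on_iff_rtrancl[OF parcs_subset] by (simp add: reachable_def)

lemma del_vert_reachable_iff:
  "u \<rightarrow>\<^sup>*\<^bsub>pre_digraph.del_vert (with_proj G) c\<^esub> w \<longleftrightarrow>
     u \<in> pverts G - {c} \<and> (u, w) \<in> (avoiding (parcs G) {c})\<^sup>*"
proof -
  have "arcs_ends (pre_digraph.del_vert (with_proj G) c) = avoiding (parcs G) {c}"
    by (force simp: pre_digraph.del_vert_def arcs_ends_def arc_to_ends_def avoiding_def)
  moreover have "verts (pre_digraph.del_vert (with_proj G) c) = pverts G - {c}"
    by (simp add: pre_digraph.del_vert_def)
  moreover have "avoiding (parcs G) {c} \<subseteq> (pverts G - {c}) \<times> (pverts G - {c})"
    using parcs_subset by (auto simp: avoiding_def)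
  ultimately show ?thesis by (simp add: reachable_def rtrancl_on_iff_rtrancl)
qed

lemma connected_iff_rtrancl:
  "Digraph_Component.connected (with_proj G) \<longleftrightarrow>
     pverts G \<noteq> {} \<and> (\<forall>u\<in>pverts G. \<forall>w\<in>pverts G. (u, w) \<in> (parcs G)\<^sup>*)"
proof -
  \<comment> \<open>\<open>connected\<close> means strong connectedness of the symmetric closure,
    which changes nothing here.\<close>
  have "parcs (mk_symmetric (with_proj G)) = parcs G"
    using sym_parcs by (auto simp: mk_symmetric_def dest: symD)
  then have "mk_symmetric (with_proj G) = G" by simp
  then show ?thesis
    by (auto simp: Digraph_Component.connected_def strongly_connected_def reachable_iff_rtrancl)
qed

lemma nonseparable_iff_biconnected:
  "nonseparable (with_proj G) \<longleftrightarrow> biconnected (pverts G) (parcs G)"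
proof
  assume ns: "nonseparable (with_proj G)"
  then have ne: "pverts G \<noteq> {}" and conn: "\<forall>u\<in>pverts G. \<forall>w\<in>pverts G. (u, w) \<in> (parcs G)\<^sup>*"
    by (auto simp: nonseparable_def connected_iff_rtrancl)
  show "biconnected (pverts G) (parcs G)"
    unfolding biconnected_def
  proof (intro conjI allI impI ballI)
    fix C c u w assume C: "C \<subseteq> {c}" and u: "u \<in> pverts G - C" and w: "w \<in> pverts G - C"
    have uw: "(u, w) \<in> (parcs G)\<^sup>*" using conn u w by blast
    show "(u, w) \<in> (avoiding (parcs G) C)\<^sup>*"
    proof (cases "C = {}")
      case True then show ?thesis using uw by simp
    next
      case False
      then have Cc: "C = {c}" using C by blast
      show ?thesis
      proof (cases "c \<in> pverts G")
        case True
        have "\<not> cut_vertex (with_proj G) c" using ns by (simp add: nonseparable_def)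
        then have "u \<rightarrow>\<^sup>*\<^bsub>pre_digraph.del_vert (with_proj G) c\<^esub> w"
          using True u w uw Cc reachable_iff_rtrancl[of u w] unfolding cut_vertex_def by auto
        then show ?thesis using Cc by (simp add: del_vert_reachable_iff)
      next
        case False
        \<comment> \<open>\<open>cut_vertex\<close> speaks of vertices of the graph only; deleting a
          point outside it has no effect.\<close>
        then have "avoiding (parcs G) C = parcs G"
          using Cc parcs_subset by (auto simp: avoiding_def)
        then show ?thesis using uw by simp
      qed
    qed
  qed (use ne parcs_subset sym_parcs in auto)
next
  assume bi: "biconnected (pverts G) (parcs G)"
  have "u \<rightarrow>\<^sup>*\<^bsub>pre_digraph.del_vert (with_proj G) c\<^esub> w"
    if "u \<noteq> c" "w \<noteq> c" "u \<rightarrow>\<^sup>*\<^bsub>with_proj G\<^esub> w" for c u w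
  proof -
    have "u \<in> pverts G" "w \<in> pverts G" using that(3) reachable_in_verts by blast+
    then show ?thesis
      using biconnectedD[OF bi, of "{c}" c u w] that by (simp add: del_vert_reachable_iff)
  qed
  then have "\<not> cut_vertex (with_proj G) c" for c unfolding cut_vertex_def by blast
  moreover have "Digraph_Component.connected (with_proj G)"
    using biconnectedD[OF bi, of "{}"] bi by (simp add: connected_iff_rtrancl biconnected_def)
  ultimately show "nonseparable (with_proj G)"
    using pair_graphD_graph by (simp add: nonseparable_def)
qed

lemma pair_graph_sub:
  assumes "W \<subseteq> pverts G" "F \<subseteq> parcs G" "F \<subseteq> W \<times> W" "sym F"
  shows "pair_graph \<lparr>pverts = W, parcs = F\<rparr>"
proof
  show "finite (pverts \<lparr>pverts = W, parcs = F\<rparr>)" "finite (parcs \<lparr>pverts = W, parcs = F\<rparr>)"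
    using finite_subset[OF assms(1) pair_finite_verts] finite_subset[OF assms(2) pair_finite_arcs]
    by simp_all
  show "symmetric (with_proj \<lparr>pverts = W, parcs = F\<rparr>)" using assms by (simp add: symmetric_def)
  fix e assume "e \<in> parcs \<lparr>pverts = W, parcs = F\<rparr>"
  then show "fst e \<in> pverts \<lparr>pverts = W, parcs = F\<rparr>" "snd e \<in> pverts \<lparr>pverts = W, parcs = F\<rparr>"
    "fst e \<noteq> snd e" using assms pair_no_loops by auto
qed

lemma connected_relation:
  assumes "Digraph_Component.connected (with_proj G)"
  shows "connected_relation (pverts G) (parcs G)"
  using assms parcs_subset sym_parcs irrefl_parcs pair_finite_verts
  by unfold_locales (auto simp: connected_iff_rtrancl)

text \<open>\<open>graph_dist\<close> minimises over paths and \<open>rdist\<close> over walks.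
  Removing cycles never lengthens a walk, so the minima agree.\<close>

lemma graph_dist_eq_rdist:
  assumes "u \<in> pverts G"
  shows "graph_dist G u w = rdist (parcs G) u w"
proof -
  have walk: "(u, w) \<in> parcs G ^^ length p" if "awalk u p w" for u p
    using that
  proof (induction p arbitrary: u)
    case (Cons e p)
    then have "e \<in> parcs G" "fst e = u" "awalk (snd e) p w" by (auto simp: awalk_Cons_iff)
    then have "(u, snd e) \<in> parcs G" "(snd e, w) \<in> parcs G ^^ length p"
      using Cons.IH by (auto simp: prod_eq_iff)
    then show ?case unfolding list.size by (metis add_Suc_right add_0_right relpow_Suc_I2)
  qed (simp add: awalk_Nil_iff)
  have path: "\<exists>p. awalk u p w \<and> length p = l" if "(u, w) \<in> parcs G ^^ l" "u \<in> pverts G" for u l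
    using that
  proof (induction l arbitrary: u)
    case 0
    then show ?case by (intro exI[of _ "[]"]) (simp add: awalk_Nil_iff)
  next
    case (Suc l)
    obtain y where y: "(u, y) \<in> parcs G" "(y, w) \<in> parcs G ^^ l"
      using relpow_Suc_D2[OF Suc.prems(1)] by blast
    then have "y \<in> pverts G" using parcs_subset by blast
    then obtain p where "awalk y p w" "length p = l" using Suc.IH y by blast
    then show ?case using y by (intro exI[of _ "(u, y) # p"]) (simp add: awalk_Cons_iff)
  qed
  have short: "\<exists>p'. apath u p' w \<and> length p' \<le> length p" if "awalk u p w" for p
    using that
  proof (induction rule: awalk_to_apath_induct)
    case (path p)
    then show ?case by (auto simp: apath_def)
  next
    case (decomp p q r s)
    then have "length (q @ s) \<le> length p" by (auto elim!: awalk_cyc_decompE)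
    then show ?case using decomp.IH by (meson le_trans)
  qed
  show ?thesis
  proof (cases "\<exists>l. (u, w) \<in> parcs G ^^ l")
    case False
    \<comment> \<open>Without a connecting walk both sides are \<open>LEAST\<close> of a predicate
      that is never true, hence the same value.\<close>
    then have "\<not> (\<exists>p. apath u p w)" using walk awalkI_apath by blast
    then show ?thesis using False by (simp add: graph_dist_def rdist_def)
  next
    case True
    then have "(u, w) \<in> parcs G ^^ rdist (parcs G) u w" by (metis rdist_def LeastI_ex)
    from path[OF this assms] obtain p0 where p0: "awalk u p0 w" "length p0 = rdist (parcs G) u w"
      by (elim exE conjE)
    from short[OF p0(1)] obtain p where p: "apath u p w" "length p \<le> length p0"
      by (elim exE conjE)
    have le: "rdist (parcs G) u w \<le> length p" if "apath u p w" for p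
      using walk[OF awalkI_apath[OF that]] by (rule rdist_le)
    have "length p = rdist (parcs G) u w" using le[OF p(1)] p(2) p0(2) by linarith
    with p(1) le show ?thesis unfolding graph_dist_def by (intro Least_equality) auto
  qed
qed

end

section \<open>Blocks of a graph as blocks of its arc relation\<close>

lemma with_proj_inject: "with_proj H = with_proj H' \<longleftrightarrow> H = H'"
  by (auto simp: with_proj_def pair_pre_digraph.equality)

lemma pair_graph_wf_digraph:
  assumes "pair_graph H"
  shows "wf_digraph (with_proj H)"
proof -
  interpret pair_graph H by (rule assms)
  show ?thesis by (rule wf_digraph)
qed

lemma blocks_iff_block:
  assumes G: "pair_graph G" and conn: "Digraph_Component.connected (with_proj G)"
  shows "B \<in> blocks G \<longleftrightarrow> connected_relation.block (pverts G) (parcs G) (pverts B) (parcs B)"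
proof -
  interpret pair_graph G by (rule G)
  interpret connected_relation "pverts G" "parcs G" using conn by (rule connected_relation)
  show ?thesis
  proof
    assume "B \<in> blocks G"
    then have max: "max_subgraph nonseparable (with_proj B)" by (simp add: blocks_def)
    then have sub: "subgraph (with_proj B) (with_proj G)" and ns: "nonseparable (with_proj B)"
      by (auto simp: max_subgraph_def)
    have pB: "pair_graph B" using ns by (auto simp: nonseparable_def intro: pair_graphI_graph)
    have s: "pverts B \<subseteq> pverts G" "parcs B \<subseteq> parcs G" using sub by (auto simp: subgraph_def)
    show "block (pverts B) (parcs B)"
      unfolding block_def
    proof (intro conjI allI impI)
      show "biconnected (pverts B) (parcs B)"
        using ns pair_graph.nonseparable_iff_biconnected[OF pB] by blast
      fix W F assume a: "W \<subseteq> pverts G \<and> F \<subseteq> parcs G \<and> biconnected W F \<and> pverts B \<subseteq> W \<and> parcs B \<subseteq> F"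
      let ?H = "\<lparr>pverts = W, parcs = F\<rparr>"
      have "F \<subseteq> W \<times> W" "sym F" using a by (auto simp: biconnected_def)
      then have pH: "pair_graph ?H" using a by (intro pair_graph_sub) auto
      have wf: "wf_digraph (with_proj ?H)" "wf_digraph (with_proj B)"
        using pH pB by (simp_all add: pair_graph_wf_digraph)
      have "subgraph (with_proj ?H) (with_proj G)" "subgraph (with_proj B) (with_proj ?H)"
        using a wf by (auto simp: subgraph_def wf_digraph compatible_def)
      moreover have "nonseparable (with_proj ?H)"
        using a pair_graph.nonseparable_iff_biconnected[OF pH] by simp
      ultimately have "with_proj ?H = with_proj B" using max by (auto simp: max_subgraph_def)
      then have "?H = B" by (simp add: with_proj_inject)
      then show "W = pverts B" "F = parcs B" by auto
    qed (use s in auto)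
  next
    assume bl: "block (pverts B) (parcs B)"
    note b = blockD[OF bl]
    have pB: "pair_graph B"
    proof -
      have eq: "\<lparr>pverts = pverts B, parcs = parcs B\<rparr> = B"
        by (rule pair_pre_digraph.equality) simp_all
      have "sym (parcs B)" using b(3) by (simp add: biconnected_def)
      from pair_graph_sub[OF b(1,2,4) this] show ?thesis unfolding eq .
    qed
    have wfB: "wf_digraph (with_proj B)"
      using pB by (rule pair_graph_wf_digraph)
    have "max_subgraph nonseparable (with_proj B)"
      unfolding max_subgraph_def
    proof (intro conjI allI impI notI)
      show "subgraph (with_proj B) (with_proj G)"
        using b wfB by (auto simp: subgraph_def wf_digraph compatible_def)
      show "nonseparable (with_proj B)"
        using b pair_graph.nonseparable_iff_biconnected[OF pB] by blast
      fix H assume "H \<noteq> with_proj B \<and> subgraph (with_proj B) H"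
        and H2: "subgraph H (with_proj G) \<and> nonseparable H"
      then have H1: "H \<noteq> with_proj B" "subgraph (with_proj B) H" by auto
      let ?H = "\<lparr>pverts = verts H, parcs = arcs H\<rparr>"
      \<comment> \<open>Being a subgraph of \<open>G\<close> forces the tail and head maps of
        \<open>H\<close> to be the two projections, so a competitor is itself a pair graph.\<close>
      have HH: "H = with_proj ?H"
        using H2 by (auto simp: subgraph_def compatible_def with_proj_def)
      have "graph (with_proj ?H)" using H2 HH by (simp add: nonseparable_def)
      then have pH: "pair_graph ?H" by (rule pair_graphI_graph)
      have "biconnected (verts H) (arcs H)"
        using H2 HH pair_graph.nonseparable_iff_biconnected[OF pH] by simp
      then have "verts H = pverts B \<and> arcs H = parcs B"
        using H1 H2 by (intro block_maximal[OF bl]) (auto simp: subgraph_def)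
      then have "?H = B" by simp
      then show False using HH H1 by simp
    qed
    then show "B \<in> blocks G" by (simp add: blocks_def)
  qed
qed

text \<open>Every arc between the library's parts \<open>U\<close> and \<open>V\<close> crosses from
  \<open>X\<close> to \<open>Y\<close> or back. One vertex \<open>u\<close> thus fixes the side of
  all of \<open>V\<close>, and \<open>V\<close> the side of all of \<open>U\<close>; the bounds on
  \<open>m\<close> and \<open>n\<close> provide these vertices.\<close>

lemma complete_bipartite_parts:
  assumes "K\<^bsub>m,n\<^esub> (with_proj B)" "m \<ge> 1" "n \<ge> 1" "bipartition B X Y"
  shows "parcs B = X \<times> Y \<union> Y \<times> X"
proof -
  obtain U V where UV: "pverts B = U \<union> V" "U \<inter> V = {}" "card U = m" "card V = n"
    "parcs B = U \<times> V \<union> V \<times> U"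
    using assms(1) unfolding complete_bipartite_digraph_pair_def by blast
  have "U \<noteq> {}" "V \<noteq> {}" using UV assms(2,3) by auto
  then obtain u v where uv: "u \<in> U" "v \<in> V" by blast
  have XY: "U \<union> V = X \<union> Y" "X \<inter> Y = {}" "U \<times> V \<subseteq> X \<times> Y \<union> Y \<times> X"
    using assms(4) UV(1,5) by (auto simp: bipartition_def)
  have edge: "(a \<in> X \<longleftrightarrow> b \<in> Y) \<and> (a \<in> Y \<longleftrightarrow> b \<in> X)" if "a \<in> U" "b \<in> V" for a b
    using XY(2,3) that by blast
  have "U = X \<and> V = Y \<or> U = Y \<and> V = X"
  proof (cases "u \<in> X")
    case True
    then have "V \<subseteq> Y" using edge uv by blast
    moreover from this have "U \<subseteq> X" using edge uv by blast
    ultimately show ?thesis using XY(1,2) by blast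
  next
    case False
    then have "u \<in> Y" using uv XY by blast
    then have "V \<subseteq> X" using edge uv by blast
    moreover from this have "U \<subseteq> Y" using edge uv by blast
    ultimately show ?thesis using XY(1,2) by blast
  qed
  then show ?thesis using UV(5) by blast
qed

section \<open>A single complete bipartite block\<close>

lemma sum_split_at:
  assumes "finite X" "w \<in> X"
  shows "(\<Sum>z\<in>X. f z * (b + of_bool (z = w) * c)) = b * (\<Sum>z\<in>X. f z) + f w * (c :: 'k::comm_ring_1)"
proof -
  have "(\<Sum>z\<in>X. f z * (b + of_bool (z = w) * c)) = (\<Sum>z\<in>X. b * f z) + (\<Sum>z\<in>X. if z = w then f z * c else 0)"
    unfolding sum.distrib[symmetric] by (intro sum.cong) (auto simp: algebra_simps)
  then show ?thesis using assms by (simp add: sum_distrib_left)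
qed

lemma sum_except_one:
  assumes "finite X" "a \<in> X"
  shows "(\<Sum>z\<in>X. if a = z then 0 else c) = (of_nat (card X) - 1) * (c :: 'k::comm_ring_1)"
proof -
  have "(\<Sum>z\<in>X. if a = z then 0 else c) = (\<Sum>z\<in>X. c - (if a = z then c else 0))"
    by (intro sum.cong) auto
  then show ?thesis using assms by (simp add: sum_subtractf algebra_simps)
qed

lemma q_int_add: "q_int q (s + t) = q_int q s + q ^ s * q_int q t"
  unfolding q_int_def
  by (induction t) (auto simp: algebra_simps power_add)

lemma q_int_telescope: "(q - 1) * q_int q s = q ^ s - 1"
  unfolding q_int_def by (rule power_diff_1_eq[symmetric])

lemma q_int_0 [simp]: "q_int q 0 = 0" and q_int_1: "q_int q 1 = 1" and q_int_2: "q_int q 2 = 1 + q"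
  by (simp_all add: q_int_def numeral_2_eq_2)

lemma Delta_commute: "Delta q m n = Delta q n m"
  by (simp add: Delta_def mult_ac)

text \<open>
  This is the matrix \<open>L\<close> of a graph with the single block \<open>(X, Y)\<close>, extended by zero: there
  \<open>diag(y)\<close> has the same coefficients as \<open>B\<close>.
\<close>

definition block_L :: "'k::real_normed_field \<Rightarrow> 'a set \<Rightarrow> 'a set \<Rightarrow> 'a \<Rightarrow> 'a \<Rightarrow> 'k" where
  "block_L q X Y z w = (let D = (q + 1) * Delta q (card X) (card Y) in
     if z \<in> X \<and> w \<in> X then - (q\<^sup>2 * (of_nat (card Y) - 1)) / D + of_bool (z = w) * (1 / (q + 1))
     else if z \<in> Y \<and> w \<in> Y then - (q\<^sup>2 * (of_nat (card X) - 1)) / D + of_bool (z = w) * (1 / (q + 1))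
     else if (z, w) \<in> X \<times> Y \<union> Y \<times> X then q / D
     else 0)"

text \<open>The summand of \<open>x_entry\<close> that belongs to one block; the correction by the
  number of blocks at \<open>w\<close> is added only when blocks are glued.\<close>

definition block_x :: "'k::real_normed_field \<Rightarrow> 'a set \<Rightarrow> 'a set \<Rightarrow> 'a \<Rightarrow> 'k" where
  "block_x q X Y w =
     (if w \<in> X then (q * (of_nat (card Y) - 1) - 1) / ((q + 1) * Delta q (card X) (card Y)) else 0)
   + (if w \<in> Y then (q * (of_nat (card X) - 1) - 1) / ((q + 1) * Delta q (card X) (card Y)) else 0)"

text \<open>The distance inside the complete bipartite graph on nonempty parts, meant for
  \<open>a\<close> and \<open>z\<close> in the union of the parts.\<close>

definition part_dist :: "'a set \<Rightarrow> 'a set \<Rightarrow> 'a \<Rightarrow> 'a \<Rightarrow> nat" where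
  "part_dist X Y a z = (if a = z then 0 else if (a, z) \<in> X \<times> Y \<union> Y \<times> X then 1 else 2)"

text \<open>Symmetry in the two parts, so that computations can assume that \<open>w\<close> lies in
  \<open>X\<close>. Disjointness makes the order of the cases in \<open>block_L\<close>
  immaterial.\<close>

lemma block_L_commute:
  assumes "X \<inter> Y = {}"
  shows "block_L q X Y z w = block_L q Y X z w"
proof -
  have "\<not> (z \<in> X \<and> z \<in> Y)" using assms by blast
  then show ?thesis
    unfolding block_L_def Let_def Delta_commute[of q "card X" "card Y"]
    by (cases "z \<in> X"; cases "z \<in> Y"; cases "w \<in> X"; cases "w \<in> Y") simp_all
qed

lemma block_x_commute: "block_x q X Y w = block_x q Y X w"
  unfolding block_x_def Delta_commute[of q "card X" "card Y"] by (rule add.commute)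

lemma part_dist_commute: "part_dist X Y a z = part_dist Y X a z"
  by (auto simp: part_dist_def)

text \<open>The column of \<open>w\<close> is constant on \<open>Y\<close>, and on \<open>X\<close>
  up to an extra diagonal term. The weight \<open>f\<close> is later the constant 1 for column sums
  and the q-distance from \<open>a\<close> for the product.\<close>

lemma block_sum:
  fixes q :: "'k::real_normed_field"
  assumes "finite X" "finite Y" "X \<inter> Y = {}" "w \<in> X"
  defines "D \<equiv> (q + 1) * Delta q (card X) (card Y)"
  shows "(\<Sum>z\<in>X \<union> Y. f z * block_L q X Y z w) =
    - (q\<^sup>2 * (of_nat (card Y) - 1)) / D * (\<Sum>z\<in>X. f z) + f w / (q + 1) + (\<Sum>z\<in>Y. f z) * (q / D)"
proof -
  have "(\<Sum>z\<in>X \<union> Y. f z * block_L q X Y z w) =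
      (\<Sum>z\<in>X. f z * block_L q X Y z w) + (\<Sum>z\<in>Y. f z * block_L q X Y z w)"
    using assms by (intro sum.union_disjoint) auto
  also have "(\<Sum>z\<in>X. f z * block_L q X Y z w) =
      (\<Sum>z\<in>X. f z * (- (q\<^sup>2 * (of_nat (card Y) - 1)) / D + of_bool (z = w) * (1 / (q + 1))))"
    using assms by (intro sum.cong) (auto simp: block_L_def Let_def)
  also have "(\<Sum>z\<in>Y. f z * block_L q X Y z w) = (\<Sum>z\<in>Y. f z * (q / D))"
    using assms by (intro sum.cong) (auto simp: block_L_def Let_def)
  finally show ?thesis
    unfolding sum_split_at[OF assms(1,4)] sum_distrib_right by simp
qed

lemma block_column_sum:
  fixes q :: "'k::real_normed_field"
  assumes "finite X" "finite Y" "X \<inter> Y = {}" "w \<in> X \<union> Y" "q \<noteq> - 1" "Delta q (card X) (card Y) \<noteq> 0"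
  shows "(\<Sum>z\<in>X \<union> Y. block_L q X Y z w) = (1 - q) * block_x q X Y w"
proof -
  \<comment> \<open>The claim is stated for arbitrary parts with \<open>w\<close> in the first one,
    so that the other case follows by exchanging them.\<close>
  have *: "(\<Sum>z\<in>X \<union> Y. block_L q X Y z w) = (1 - q) * block_x q X Y w"
    if "finite X" "finite Y" "X \<inter> Y = {}" "w \<in> X" "Delta q (card X) (card Y) \<noteq> 0" for X Y :: "'a set"
  proof -
    have q1: "q + 1 \<noteq> 0" using assms(5) by (simp add: add_eq_0_iff2)
    have wY: "w \<notin> Y" using that by blast
    define m n :: 'k where mn: "m = of_nat (card X)" "n = of_nat (card Y)"
    define d where "d = Delta q (card X) (card Y)"
    have d: "d = q\<^sup>2 * (m - 1) * (n - 1) - 1" "d \<noteq> 0" using that mn by (auto simp: d_def Delta_def)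
    have "(\<Sum>z\<in>X \<union> Y. block_L q X Y z w) =
        - (q\<^sup>2 * (n - 1)) / ((q + 1) * d) * m + 1 / (q + 1) + n * (q / ((q + 1) * d))"
      using block_sum[OF that(1-4), of "\<lambda>_. 1" q] by (simp add: mn d_def)
    also have "\<dots> = (- (q\<^sup>2 * (n - 1)) * m + d + n * q) / ((q + 1) * d)"
      using q1 d(2) by (simp add: divide_simps)
    \<comment> \<open>Inserting \<open>d\<close>, the terms containing \<open>m\<close> combine to
      \<open>- q\<^sup>2 * (n - 1)\<close>, and the rest factors.\<close>
    also have "- (q\<^sup>2 * (n - 1)) * m + d + n * q = (1 - q) * (q * (n - 1) - 1)"
      unfolding d(1) by (simp add: algebra_simps power2_eq_square)
    finally show ?thesis using that(4) wY by (simp add: block_x_def mn d_def)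
  qed
  show ?thesis
  proof (cases "w \<in> X")
    case True then show ?thesis using * assms by blast
  next
    case False
    have "(\<Sum>z\<in>Y \<union> X. block_L q Y X z w) = (1 - q) * block_x q Y X w"
      by (rule *) (use assms False Delta_commute[of q "card Y" "card X"] in auto)
    then show ?thesis
      unfolding block_L_commute[OF assms(3)] block_x_commute[of q X Y] Un_commute[of X Y] .
  qed
qed

lemma block_row_sum:
  fixes q :: "'k::real_normed_field"
  assumes "finite X" "finite Y" "X \<inter> Y = {}" "w \<in> X \<union> Y" "a \<in> X \<union> Y" "q \<noteq> - 1"
    "Delta q (card X) (card Y) \<noteq> 0"
  shows "(\<Sum>z\<in>X \<union> Y. q_int q (part_dist X Y a z) * block_L q X Y z w) = block_x q X Y w - of_bool (a = w)"
proof -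
  have *: "(\<Sum>z\<in>X \<union> Y. q_int q (part_dist X Y a z) * block_L q X Y z w) = block_x q X Y w - of_bool (a = w)"
    if "finite X" "finite Y" "X \<inter> Y = {}" "w \<in> X" "a \<in> X \<union> Y" "Delta q (card X) (card Y) \<noteq> 0"
    for X Y :: "'a set"
  proof -
    let ?f = "\<lambda>z. q_int q (part_dist X Y a z)"
    have q1: "q + 1 \<noteq> 0" using assms(6) by (simp add: add_eq_0_iff2)
    have wY: "w \<notin> Y" using that by blast
    define m n :: 'k where mn: "m = of_nat (card X)" "n = of_nat (card Y)"
    define d where "d = Delta q (card X) (card Y)"
    have d: "d = q\<^sup>2 * (m - 1) * (n - 1) - 1" "d \<noteq> 0" using that mn by (auto simp: d_def Delta_def)
    have S: "(\<Sum>z\<in>X \<union> Y. ?f z * block_L q X Y z w) =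
        - (q\<^sup>2 * (n - 1)) / ((q + 1) * d) * (\<Sum>z\<in>X. ?f z) + ?f w / (q + 1) + (\<Sum>z\<in>Y. ?f z) * (q / ((q + 1) * d))"
      using block_sum[OF that(1-4), of ?f q] by (simp add: mn d_def)
    have bx: "block_x q X Y w = (q * (n - 1) - 1) / ((q + 1) * d)"
      using that(4) wY by (simp add: block_x_def mn d_def)
    show ?thesis
    proof (cases "a \<in> X")
      case True
      then have aY: "a \<notin> Y" using that by blast
      have "(\<Sum>z\<in>X. ?f z) = (\<Sum>z\<in>X. if a = z then 0 else 1 + q)"
        using that aY by (intro sum.cong) (auto simp: part_dist_def q_int_2)
      also have "\<dots> = (m - 1) * (1 + q)" using sum_except_one[OF that(1) True] by (simp add: mn)
      finally have X: "(\<Sum>z\<in>X. ?f z) = (m - 1) * (1 + q)" .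
      have "(\<Sum>z\<in>Y. ?f z) = (\<Sum>z\<in>Y. 1)"
        using that True by (intro sum.cong) (auto simp: part_dist_def q_int_1[unfolded One_nat_def])
      then have Y: "(\<Sum>z\<in>Y. ?f z) = n" by (simp add: mn)
      \<comment> \<open>Two vertices of the same part have q-distance 0 or \<open>1 + q\<close>;
        this quotient produces the entry of the identity matrix.\<close>
      have fw: "?f w / (q + 1) = 1 - of_bool (a = w)"
        using that aY wY q1 by (auto simp: part_dist_def q_int_2 add.commute)
      have "- (q\<^sup>2 * (n - 1)) / ((q + 1) * d) * ((m - 1) * (1 + q)) + 1 + n * (q / ((q + 1) * d))
          = (- (q\<^sup>2 * (n - 1)) * ((m - 1) * (1 + q)) + (q + 1) * d + n * q) / ((q + 1) * d)"
        using q1 d(2) by (simp add: divide_simps)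
      \<comment> \<open>The product \<open>q\<^sup>2 * (m - 1) * (n - 1)\<close> cancels against the
        one in \<open>d\<close>, leaving \<open>- (q + 1) + n * q\<close>.\<close>
      also have "- (q\<^sup>2 * (n - 1)) * ((m - 1) * (1 + q)) + (q + 1) * d + n * q = q * (n - 1) - 1"
        unfolding d(1) by (simp add: algebra_simps power2_eq_square)
      finally show ?thesis unfolding S X Y fw bx by (simp add: algebra_simps)
    next
      case False
      then have aY: "a \<in> Y" using that by blast
      have aw: "a \<noteq> w" using False that by blast
      have "(\<Sum>z\<in>Y. ?f z) = (\<Sum>z\<in>Y. if a = z then 0 else 1 + q)"
        using that aY by (intro sum.cong) (auto simp: part_dist_def q_int_2)
      also have "\<dots> = (n - 1) * (1 + q)" using sum_except_one[OF that(2) aY] by (simp add: mn)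
      finally have Y: "(\<Sum>z\<in>Y. ?f z) = (n - 1) * (1 + q)" .
      have "(\<Sum>z\<in>X. ?f z) = (\<Sum>z\<in>X. 1)"
        using that aY by (intro sum.cong) (auto simp: part_dist_def q_int_1[unfolded One_nat_def])
      then have X: "(\<Sum>z\<in>X. ?f z) = m" by (simp add: mn)
      have fw: "?f w = 1"
        using that aY aw by (auto simp: part_dist_def q_int_1[unfolded One_nat_def])
      have "- (q\<^sup>2 * (n - 1)) / ((q + 1) * d) * m + 1 / (q + 1) + (n - 1) * (1 + q) * (q / ((q + 1) * d))
          = (- (q\<^sup>2 * (n - 1)) * m + d + (n - 1) * (1 + q) * q) / ((q + 1) * d)"
        using q1 d(2) by (simp add: divide_simps)
      also have "- (q\<^sup>2 * (n - 1)) * m + d + (n - 1) * (1 + q) * q = q * (n - 1) - 1"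
        unfolding d(1) by (simp add: algebra_simps power2_eq_square)
      finally show ?thesis unfolding S X Y fw bx using aw by simp
    qed
  qed
  show ?thesis
  proof (cases "w \<in> X")
    case True then show ?thesis using * assms by blast
  next
    case False
    have "(\<Sum>z\<in>Y \<union> X. q_int q (part_dist Y X a z) * block_L q Y X z w) =
        block_x q Y X w - of_bool (a = w)"
      by (rule *) (use assms False Delta_commute[of q "card Y" "card X"] in auto)
    then show ?thesis
      unfolding block_L_commute[OF assms(3)] block_x_commute[of q X Y] part_dist_commute[of X Y]
        Un_commute[of X Y] .
  qed
qed

section \<open>Gluing the blocks\<close>

text \<open>A definite description with at most one candidate becomes a sum over all indices, which
  can then be compared block by block.\<close>

lemma let_the_eq_sum:
  fixes f :: "'i \<Rightarrow> 'k::comm_monoid_add"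
  assumes "finite K" "\<And>k j. k \<in> K \<Longrightarrow> j \<in> K \<Longrightarrow> P k \<Longrightarrow> P j \<Longrightarrow> k = j"
  shows "(if \<exists>k\<in>K. P k then let k = (THE k. k \<in> K \<and> P k) in f k else 0) =
    (\<Sum>k\<in>K. if P k then f k else 0)"
proof (cases "\<exists>k\<in>K. P k")
  case True
  then obtain k where k: "k \<in> K" "P k" by blast
  then have "(THE k. k \<in> K \<and> P k) = k" using assms(2) by blast
  moreover have "{j \<in> K. P j} = {k}" using k assms(2) by blast
  ultimately show ?thesis using True sum.inter_filter[OF assms(1), of f P] by (simp add: Let_def)
next
  case False
  then show ?thesis by (simp add: sum.neutral)
qed

text \<open>What the gluing argument uses of a bi-block graph. Blocks are identified by their vertex
  sets alone, on which gates depend.\<close>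

locale bi_block_decomposition = connected_relation V E for V :: "'a set" and E +
  fixes r :: nat and X Y :: "nat \<Rightarrow> 'a set"
  assumes part_block: "k \<in> {1..r} \<Longrightarrow> block (X k \<union> Y k) (X k \<times> Y k \<union> Y k \<times> X k)"
    and parts_disjoint: "k \<in> {1..r} \<Longrightarrow> X k \<inter> Y k = {}"
    and parts_nonempty: "k \<in> {1..r} \<Longrightarrow> X k \<noteq> {} \<and> Y k \<noteq> {}"
    and every_block: "block W F \<Longrightarrow> \<exists>k\<in>{1..r}. W = X k \<union> Y k"
    and parts_inj: "k \<in> {1..r} \<Longrightarrow> j \<in> {1..r} \<Longrightarrow> X k \<union> Y k = X j \<union> Y j \<Longrightarrow> k = j"
begin

abbreviation W :: "nat \<Rightarrow> 'a set" where
  "W k \<equiv> X k \<union> Y k"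

definition gate :: "nat \<Rightarrow> 'a \<Rightarrow> 'a" where
  "gate k u = (SOME a. a \<in> W k \<and> (\<forall>z\<in>W k - {a}. (u, z) \<notin> (avoiding E {a})\<^sup>*))"

lemma W_subset: "k \<in> {1..r} \<Longrightarrow> W k \<subseteq> V"
  using blockD(1)[OF part_block] .

lemma finite_parts: "k \<in> {1..r} \<Longrightarrow> finite (X k)" "k \<in> {1..r} \<Longrightarrow> finite (Y k)"
  using W_subset finite_V by (meson finite_subset le_sup_iff)+

lemma W_meet:
  assumes "k \<in> {1..r}" "j \<in> {1..r}" "x \<in> W k" "x \<in> W j" "y \<in> W k" "y \<in> W j" "x \<noteq> y"
  shows "k = j"
  using assms block_eq(1)[OF part_block[OF assms(1)] part_block[OF assms(2)], of x y] parts_inj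
  by blast

lemma gate:
  assumes "k \<in> {1..r}" "u \<in> V"
  shows "gate k u \<in> W k" "\<And>z. z \<in> W k \<Longrightarrow> z \<noteq> gate k u \<Longrightarrow> (u, z) \<notin> (avoiding E {gate k u})\<^sup>*"
proof -
  have "\<exists>a. a \<in> W k \<and> (\<forall>z\<in>W k - {a}. (u, z) \<notin> (avoiding E {a})\<^sup>*)"
    using block_gate[OF part_block[OF assms(1)] assms(2)] by blast
  from someI_ex[OF this] show "gate k u \<in> W k"
    "\<And>z. z \<in> W k \<Longrightarrow> z \<noteq> gate k u \<Longrightarrow> (u, z) \<notin> (avoiding E {gate k u})\<^sup>*"
    unfolding gate_def by auto
qed

text \<open>The empty walk at \<open>u\<close> avoids every vertex other than
  \<open>u\<close>.\<close>

lemma gate_self: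
  assumes "k \<in> {1..r}" "u \<in> W k"
  shows "gate k u = u"
  using gate(2)[OF assms(1) subsetD[OF W_subset[OF assms(1)] assms(2)] assms(2)] by fastforce

lemma rdist_gate:
  assumes "k \<in> {1..r}" "u \<in> V" "z \<in> W k"
  shows "rdist E u z = rdist E u (gate k u) + rdist E (gate k u) z"
proof (cases "z = gate k u")
  case False
  then show ?thesis
    using gate[OF assms(1,2)] assms W_subset[OF assms(1)] by (intro rdist_through conn) auto
qed simp

lemma rdist_in_block:
  assumes k: "k \<in> {1..r}" and "a \<in> W k" "z \<in> W k"
  shows "rdist E a z = part_dist (X k) (Y k) a z"
proof -
  let ?F = "X k \<times> Y k \<union> Y k \<times> X k"
  have F: "?F \<subseteq> E" using blockD(2)[OF part_block[OF k]] .
  consider "a = z" | "a \<noteq> z" "(a, z) \<in> ?F" | "a \<noteq> z" "(a, z) \<notin> ?F" by blast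
  then show ?thesis
  proof cases
    case 2
    then show ?thesis using F rdist_edge[of a z E] by (auto simp: part_dist_def)
  next
    case 3
    \<comment> \<open>Vertices of the same part are not adjacent in the whole graph either, but have
      a common neighbour in the opposite part.\<close>
    then have nE: "(a, z) \<notin> E" using block_induced[OF part_block[OF k] assms(2,3)] by blast
    obtain y where "(a, y) \<in> ?F" "(y, z) \<in> ?F" using 3 assms parts_nonempty[OF k] by blast
    then have "rdist E a z = 2" using F 3(1) nE by (intro rdist_two) auto
    then show ?thesis using 3 by (simp add: part_dist_def)
  qed (simp add: part_dist_def)
qed

lemma card_other_gates:
  assumes "u \<in> V" "w \<in> V"
  shows "card {k \<in> {1..r}. w \<in> W k \<and> gate k u \<noteq> w} = (if u = w then 0 else 1)"
proof (cases "u = w")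
  case True
  then have "{k \<in> {1..r}. w \<in> W k \<and> gate k u \<noteq> w} = {}" using gate_self by blast
  then have "card {k \<in> {1..r}. w \<in> W k \<and> gate k u \<noteq> w} = 0" by (simp only: card.empty)
  then show ?thesis unfolding if_P[OF True] .
next
  case False
  obtain W0 F y where y: "block W0 F" "w \<in> W0" "y \<in> W0" "y \<noteq> w" "(u, y) \<in> (avoiding E {w})\<^sup>*"
    by (rule block_gate_exists[OF assms False])
  obtain k where k: "k \<in> {1..r}" "W0 = W k" using every_block[OF y(1)] by blast
  \<comment> \<open>Were \<open>w\<close> the gate, \<open>y\<close> could not be reached from
    \<open>u\<close> around \<open>w\<close>.\<close>
  have gk: "gate k u \<noteq> w"
  proof
    assume "gate k u = w"
    then show False using gate(2)[OF k(1) assms(1), of y] y k by simp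
  qed
  have "j = k" if j: "j \<in> {1..r}" "w \<in> W j" "gate j u \<noteq> w" for j
  proof (rule ccontr)
    assume "j \<noteq> k"
    then have "W j \<noteq> W k" using parts_inj j k by blast
    then show False
      using block_gate_unique[OF part_block[OF j(1)] part_block[OF k(1)], of w u "gate j u" "gate k u"]
        gate[OF j(1) assms(1)] gate[OF k(1) assms(1)] j k y gk assms(1) by auto
  qed
  then have "{k \<in> {1..r}. w \<in> W k \<and> gate k u \<noteq> w} = {k}" using k y gk by blast
  then show ?thesis using False by simp
qed

lemma card_blocks_at:
  "of_nat (card {k \<in> {1..r}. w \<in> W k}) = (\<Sum>k\<in>{1..r}. if w \<in> W k then 1 else (0 :: 'k::semiring_1))"
  by (simp add: sum.inter_filter[symmetric])

lemma block_contribution: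
  fixes q :: "'k::real_normed_field"
  assumes "k \<in> {1..r}" "u \<in> V" "w \<in> V" "q \<noteq> - 1" "Delta q (card (X k)) (card (Y k)) \<noteq> 0"
  shows "(\<Sum>z\<in>V. q_int q (rdist E u z) * block_L q (X k) (Y k) z w) =
    block_x q (X k) (Y k) w - (if w \<in> W k \<and> gate k u = w then q ^ rdist E u w else 0)"
proof (cases "w \<in> W k")
  case False
  then have "block_L q (X k) (Y k) z w = 0" for z by (auto simp: block_L_def Let_def)
  then show ?thesis using False by (simp add: block_x_def)
next
  case True
  let ?a = "gate k u"
  let ?L = "\<lambda>z. block_L q (X k) (Y k) z w"
  let ?s = "rdist E u ?a"
  note k = assms(1)
  note g = gate(1)[OF k assms(2)]
  have "(\<Sum>z\<in>V. q_int q (rdist E u z) * ?L z) = (\<Sum>z\<in>W k. q_int q (rdist E u z) * ?L z)"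
    using W_subset[OF k] finite_V
    by (intro sum.mono_neutral_right) (auto simp: block_L_def Let_def)
  also have "\<dots> = (\<Sum>z\<in>W k. q_int q ?s * ?L z +
      q ^ ?s * (q_int q (part_dist (X k) (Y k) ?a z) * ?L z))"
  proof (rule sum.cong[OF refl])
    fix z assume "z \<in> W k"
    then have "rdist E u z = ?s + part_dist (X k) (Y k) ?a z"
      using rdist_gate[OF k assms(2)] rdist_in_block[OF k g] by simp
    then show "q_int q (rdist E u z) * ?L z = q_int q ?s * ?L z +
      q ^ ?s * (q_int q (part_dist (X k) (Y k) ?a z) * ?L z)"
      by (simp add: q_int_add algebra_simps)
  qed
  also have "\<dots> = q_int q ?s * ((1 - q) * block_x q (X k) (Y k) w) +
      q ^ ?s * (block_x q (X k) (Y k) w - of_bool (?a = w))"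
    unfolding sum.distrib sum_distrib_left[symmetric]
    using block_column_sum[OF finite_parts[OF k] parts_disjoint[OF k] True assms(4,5)]
      block_row_sum[OF finite_parts[OF k] parts_disjoint[OF k] True g assms(4,5)] by simp
  \<comment> \<open>The coefficient of \<open>block_x\<close> is 1, since
    \<open>(q - 1) * q_int q s = q ^ s - 1\<close>. What remains is the power of \<open>q\<close>,
    whose exponent is the distance to \<open>w\<close> when the gate is \<open>w\<close>.\<close>
  also have "\<dots> = (q ^ ?s - (q - 1) * q_int q ?s) * block_x q (X k) (Y k) w - q ^ ?s * of_bool (?a = w)"
    by (simp add: algebra_simps)
  also have "\<dots> = block_x q (X k) (Y k) w - q ^ ?s * of_bool (?a = w)"
    by (simp add: q_int_telescope)
  finally show ?thesis using True by auto
qed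

lemma row_identity:
  fixes q :: "'k::real_normed_field"
  assumes "u \<in> V" "w \<in> V" "q \<noteq> - 1" "\<And>k. k \<in> {1..r} \<Longrightarrow> Delta q (card (X k)) (card (Y k)) \<noteq> 0"
  defines "d \<equiv> of_nat (card {k \<in> {1..r}. w \<in> W k}) - (1 :: 'k)"
  shows "(\<Sum>z\<in>V. q_int q (rdist E u z) *
      ((\<Sum>k\<in>{1..r}. block_L q (X k) (Y k) z w) + of_bool (z = w) * (d * (q - 1)))) + of_bool (u = w)
    = (\<Sum>k\<in>{1..r}. block_x q (X k) (Y k) w) - d"
proof -
  let ?D = "\<lambda>z. q_int q (rdist E u z)"
  let ?g = "of_nat (card {k \<in> {1..r}. w \<in> W k \<and> gate k u = w}) :: 'k"
  have "{k \<in> {1..r}. w \<in> W k} = {k \<in> {1..r}. w \<in> W k \<and> gate k u = w} \<union>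
      {k \<in> {1..r}. w \<in> W k \<and> gate k u \<noteq> w}" by blast
  then have "card {k \<in> {1..r}. w \<in> W k} = card {k \<in> {1..r}. w \<in> W k \<and> gate k u = w} +
      card {k \<in> {1..r}. w \<in> W k \<and> gate k u \<noteq> w}"
    by (simp add: card_Un_disjoint[symmetric] disjoint_iff)
  \<comment> \<open>Among the blocks at \<open>w\<close>, all but one have gate \<open>w\<close> if
    \<open>u\<close> differs from \<open>w\<close>, and all of them if it does not.\<close>
  then have g: "?g = d + of_bool (u = w)"
    unfolding card_other_gates[OF assms(1,2)] d_def by (auto simp: algebra_simps)
  have "(\<Sum>z\<in>V. ?D z * ((\<Sum>k\<in>{1..r}. block_L q (X k) (Y k) z w) + of_bool (z = w) * (d * (q - 1))))
      = (\<Sum>z\<in>V. \<Sum>k\<in>{1..r}. ?D z * block_L q (X k) (Y k) z w)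
        + (\<Sum>z\<in>V. if z = w then ?D z * (d * (q - 1)) else 0)"
    unfolding sum.distrib[symmetric] by (intro sum.cong) (auto simp: sum_distrib_left algebra_simps)
  also have "(\<Sum>z\<in>V. if z = w then ?D z * (d * (q - 1)) else 0) = d * ((q - 1) * ?D w)"
    using finite_V assms(2) by (simp add: mult_ac)
  also have "\<dots> = d * (q ^ rdist E u w - 1)" by (simp add: q_int_telescope)
  also have "(\<Sum>z\<in>V. \<Sum>k\<in>{1..r}. ?D z * block_L q (X k) (Y k) z w)
      = (\<Sum>k\<in>{1..r}. block_x q (X k) (Y k) w - (if w \<in> W k \<and> gate k u = w then q ^ rdist E u w else 0))"
    unfolding sum.swap[of _ "{1..r}" V]
    by (intro sum.cong block_contribution assms refl)
  also have "\<dots> = (\<Sum>k\<in>{1..r}. block_x q (X k) (Y k) w) - ?g * q ^ rdist E u w"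
    unfolding sum_subtractf by (subst sum.inter_filter[symmetric]) simp_all
  \<comment> \<open>The terms \<open>d * q ^ rdist E u w\<close> cancel; for \<open>u = w\<close>
    the remaining power has exponent 0 and cancels against the identity matrix.\<close>
  finally show ?thesis unfolding g by (auto simp: algebra_simps)
qed

text \<open>Off the diagonal at most one block contains both vertices. On the diagonal the block
  matrices count \<open>1 / (q + 1)\<close> once per block and omit the correction in
  \<open>y_entry\<close>; the two discrepancies make up the diagonal term.\<close>

lemma L_entry:
  fixes q :: "'k::real_normed_field"
  assumes "q \<noteq> - 1"
    and B: "\<And>k. k \<in> {1..r} \<Longrightarrow> parcs (B k) = X k \<times> Y k \<union> Y k \<times> X k"
    and nb: "num_blocks_at G w = card {k \<in> {1..r}. w \<in> W k}"
  shows "q / (q + 1) * A_entry q r B X Y z w - q\<^sup>2 / (q + 1) * B_entry q r X Y z w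
      - q\<^sup>2 / (q + 1) * (of_bool (z = w) * y_entry q G r X Y w) + 1 / (q + 1) * of_bool (z = w)
    = (\<Sum>k\<in>{1..r}. block_L q (X k) (Y k) z w)
      + of_bool (z = w) * ((of_nat (num_blocks_at G w) - 1) * (q - 1))"
proof (cases "z = w")
  case False
  let ?D = "\<lambda>k. Delta q (card (X k)) (card (Y k))"
  let ?XX = "\<lambda>k. z \<in> X k \<and> w \<in> X k" and ?YY = "\<lambda>k. z \<in> Y k \<and> w \<in> Y k"
  let ?XY = "\<lambda>k. (z, w) \<in> X k \<times> Y k \<union> Y k \<times> X k"
  have uniq: "k = j" if "k \<in> {1..r}" "j \<in> {1..r}" "z \<in> W k" "w \<in> W k" "z \<in> W j" "w \<in> W j" for k j
    using W_meet[of k j z w] that False by blast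
  have "A_entry q r B X Y z w =
      (if \<exists>k\<in>{1..r}. (z, w) \<in> parcs (B k)
       then let k = (THE k. k \<in> {1..r} \<and> (z, w) \<in> parcs (B k)) in 1 / ?D k else 0)"
    by (rule A_entry_def)
  also have "\<dots> = (\<Sum>k\<in>{1..r}. if (z, w) \<in> parcs (B k) then 1 / ?D k else 0)"
  proof (rule let_the_eq_sum)
    fix k j assume kj: "k \<in> {1..r}" "j \<in> {1..r}" "(z, w) \<in> parcs (B k)" "(z, w) \<in> parcs (B j)"
    have "z \<in> W i \<and> w \<in> W i" if "i \<in> {1..r}" "(z, w) \<in> parcs (B i)" for i
      using that B[OF that(1)] by auto
    with kj show "k = j" by (intro uniq) simp_all
  qed simp
  also have "\<dots> = (\<Sum>k\<in>{1..r}. if ?XY k then 1 / ?D k else 0)"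
    by (intro sum.cong) (simp_all add: B)
  finally have A: "A_entry q r B X Y z w = (\<Sum>k\<in>{1..r}. if ?XY k then 1 / ?D k else 0)" .
  have X: "(if \<exists>k\<in>{1..r}. ?XX k
       then let k = (THE k. k \<in> {1..r} \<and> ?XX k) in (of_nat (card (Y k)) - 1) / ?D k else 0) =
      (\<Sum>k\<in>{1..r}. if ?XX k then (of_nat (card (Y k)) - 1) / ?D k else 0)"
    by (rule let_the_eq_sum[OF finite_atLeastAtMost]) (rule uniq; simp)
  have Y: "(if \<exists>k\<in>{1..r}. ?YY k
       then let k = (THE k. k \<in> {1..r} \<and> ?YY k) in (of_nat (card (X k)) - 1) / ?D k else 0) =
      (\<Sum>k\<in>{1..r}. if ?YY k then (of_nat (card (X k)) - 1) / ?D k else 0)"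
    by (rule let_the_eq_sum[OF finite_atLeastAtMost]) (rule uniq; simp)
  \<comment> \<open>The nested conditional in \<open>B_entry\<close> equals the sum of its two
    branches only because both conditions never hold together.\<close>
  have excl: "\<not> (\<exists>k\<in>{1..r}. ?YY k)" if "\<exists>k\<in>{1..r}. ?XX k"
  proof
    assume "\<exists>k\<in>{1..r}. ?YY k"
    with that obtain k j where "k \<in> {1..r}" "?XX k" "j \<in> {1..r}" "?YY j" by blast
    moreover from this have "k = j" using uniq by blast
    ultimately show False using parts_disjoint by blast
  qed
  have "B_entry q r X Y z w =
      (\<Sum>k\<in>{1..r}. if ?XX k then (of_nat (card (Y k)) - 1) / ?D k else 0) +
      (\<Sum>k\<in>{1..r}. if ?YY k then (of_nat (card (X k)) - 1) / ?D k else 0)"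
    unfolding X[symmetric] Y[symmetric] B_entry_def using False excl by auto
  then have Bs: "B_entry q r X Y z w = (\<Sum>k\<in>{1..r}.
      (if ?XX k then (of_nat (card (Y k)) - 1) / ?D k else 0) +
      (if ?YY k then (of_nat (card (X k)) - 1) / ?D k else 0))"
    by (simp only: sum.distrib)
  have "q / (q + 1) * A_entry q r B X Y z w - q\<^sup>2 / (q + 1) * B_entry q r X Y z w =
      (\<Sum>k\<in>{1..r}. block_L q (X k) (Y k) z w)"
    unfolding A Bs sum_distrib_left sum_subtractf[symmetric]
  proof (rule sum.cong[OF refl])
    fix k assume "k \<in> {1..r}"
    then have "\<not> (z \<in> X k \<and> z \<in> Y k)" "\<not> (w \<in> X k \<and> w \<in> Y k)" using parts_disjoint by blast+
    then show "q / (q + 1) * (if ?XY k then 1 / ?D k else 0) - q\<^sup>2 / (q + 1) *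
        ((if ?XX k then (of_nat (card (Y k)) - 1) / ?D k else 0) +
         (if ?YY k then (of_nat (card (X k)) - 1) / ?D k else 0)) = block_L q (X k) (Y k) z w"
      using False unfolding block_L_def Let_def
      by (cases "z \<in> X k"; cases "z \<in> Y k"; cases "w \<in> X k"; cases "w \<in> Y k") simp_all
  qed
  then show ?thesis using False by simp
next
  case True
  let ?D = "\<lambda>k. Delta q (card (X k)) (card (Y k))"
  let ?n = "of_nat (num_blocks_at G w) :: 'k"
  have q1: "q + 1 \<noteq> 0" using assms(1) by (simp add: add_eq_0_iff2)
  have "\<not> (\<exists>k\<in>{1..r}. (w, w) \<in> parcs (B k))" using B parts_disjoint by blast
  then have A: "A_entry q r B X Y w w = 0" by (simp only: A_entry_def if_False)
  have Bz: "B_entry q r X Y w w = 0" by (simp add: B_entry_def)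
  define y where "y = y_entry q G r X Y w"
  have ysum: "y + (?n - 1) = (\<Sum>k\<in>{1..r}. (if w \<in> X k then (of_nat (card (Y k)) - 1) / ?D k else 0) +
       (if w \<in> Y k then (of_nat (card (X k)) - 1) / ?D k else 0))"
    unfolding y_def y_entry_def sum.distrib by (simp add: sum.inter_filter[symmetric])
  have n: "?n = (\<Sum>k\<in>{1..r}. if w \<in> W k then 1 else 0)"
    unfolding nb by (rule card_blocks_at)
  have "(\<Sum>k\<in>{1..r}. block_L q (X k) (Y k) w w) =
      (\<Sum>k\<in>{1..r}. - (q\<^sup>2 / (q + 1)) * ((if w \<in> X k then (of_nat (card (Y k)) - 1) / ?D k else 0) +
       (if w \<in> Y k then (of_nat (card (X k)) - 1) / ?D k else 0)) + 1 / (q + 1) * (if w \<in> W k then 1 else 0))"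
  proof (rule sum.cong[OF refl])
    fix k assume "k \<in> {1..r}"
    then have "\<not> (w \<in> X k \<and> w \<in> Y k)" using parts_disjoint by blast
    then show "block_L q (X k) (Y k) w w = - (q\<^sup>2 / (q + 1)) *
       ((if w \<in> X k then (of_nat (card (Y k)) - 1) / ?D k else 0) +
       (if w \<in> Y k then (of_nat (card (X k)) - 1) / ?D k else 0)) + 1 / (q + 1) * (if w \<in> W k then 1 else 0)"
      unfolding block_L_def Let_def
      by (cases "w \<in> X k"; cases "w \<in> Y k") simp_all
  qed
  also have "\<dots> = - (q\<^sup>2 / (q + 1)) * (y + (?n - 1)) + 1 / (q + 1) * ?n"
    unfolding ysum unfolding n sum_distrib_left sum.distrib[symmetric] ..
  finally have S: "(\<Sum>k\<in>{1..r}. block_L q (X k) (Y k) w w) =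
      - (q\<^sup>2 / (q + 1)) * (y + (?n - 1)) + 1 / (q + 1) * ?n" .
  have "(q - 1) * (q + 1) = q\<^sup>2 - 1" by (simp add: algebra_simps power2_eq_square)
  \<comment> \<open>This difference is \<open>a - b\<close> in the regrouping below, and is the
    source of the factor \<open>q - 1\<close>.\<close>
  then have "q - 1 = q\<^sup>2 / (q + 1) - 1 / (q + 1)"
    unfolding diff_divide_distrib[symmetric] using q1 by (simp add: eq_divide_eq)
  moreover have "- a * y + b = - a * (y + (?n - 1)) + b * ?n + (?n - 1) * (a - b)" for a b
    by (simp add: algebra_simps)
  ultimately have "- (q\<^sup>2 / (q + 1)) * y + 1 / (q + 1) =
      - (q\<^sup>2 / (q + 1)) * (y + (?n - 1)) + 1 / (q + 1) * ?n + (?n - 1) * (q - 1)"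
    by (simp only:)
  then show ?thesis unfolding True A Bz S y_def[symmetric] by simp
qed

lemma x_entry_eq:
  "x_entry q G r X Y w =
     (\<Sum>k\<in>{1..r}. block_x q (X k) (Y k) w) - (of_nat (num_blocks_at G w) - 1)"
  unfolding x_entry_def block_x_def sum.distrib by (simp add: sum.inter_filter[symmetric])

end


section \<open>From the decomposition back to graphs and matrices\<close>

lemma bi_block_graph_decomposition:
  assumes "bi_block_graph G"
    and bij: "bij_betw B {1..r} (blocks G)"
    and bip: "\<And>k. k \<in> {1..r} \<Longrightarrow> bipartition (B k) (X k) (Y k)"
  shows "bi_block_decomposition (pverts G) (parcs G) r X Y"
    and "\<And>k. k \<in> {1..r} \<Longrightarrow> parcs (B k) = X k \<times> Y k \<union> Y k \<times> X k"
    and "num_blocks_at G w = card {k \<in> {1..r}. w \<in> X k \<union> Y k}"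
proof -
  have pg: "pair_graph G" and cG: "Digraph_Component.connected (with_proj G)"
    using assms(1) by (simp_all add: bi_block_graph_def)
  interpret connected_relation "pverts G" "parcs G"
    by (rule pair_graph.connected_relation[OF pg cG])
  have mem: "B k \<in> blocks G" if "k \<in> {1..r}" for k using bij_betwE[OF bij] that by blast
  show arcs: "parcs (B k) = X k \<times> Y k \<union> Y k \<times> X k" if k: "k \<in> {1..r}" for k
  proof -
    obtain m n where "m \<ge> 1" "n \<ge> 1" "K\<^bsub>m,n\<^esub> (with_proj (B k))"
      using assms(1) mem[OF k] unfolding bi_block_graph_def by blast
    then show ?thesis using complete_bipartite_parts[OF _ _ _ bip[OF k]] by blast
  qed
  have verts: "pverts (B k) = X k \<union> Y k" if "k \<in> {1..r}" for k
    using bip[OF that] by (simp add: bipartition_def)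
  have bl: "block (X k \<union> Y k) (X k \<times> Y k \<union> Y k \<times> X k)" if "k \<in> {1..r}" for k
    using iffD1[OF blocks_iff_block[OF pg cG] mem[OF that]] unfolding arcs[OF that] verts[OF that] .
  show "num_blocks_at G w = card {k \<in> {1..r}. w \<in> X k \<union> Y k}"
  proof -
    have "blocks G = B ` {1..r}" using bij by (simp add: bij_betw_def)
    then have "{H \<in> blocks G. w \<in> pverts H} = B ` {k \<in> {1..r}. w \<in> pverts (B k)}" by auto
    also have "{k \<in> {1..r}. w \<in> pverts (B k)} = {k \<in> {1..r}. w \<in> X k \<union> Y k}"
      using verts by (intro Collect_cong) auto
    finally have eq: "{H \<in> blocks G. w \<in> pverts H} = B ` {k \<in> {1..r}. w \<in> X k \<union> Y k}" .
    have "inj_on B {k \<in> {1..r}. w \<in> X k \<union> Y k}"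
      by (rule inj_on_subset[OF bij_betw_imp_inj_on[OF bij]]) auto
    then show ?thesis unfolding num_blocks_at_def eq by (rule card_image)
  qed
  show "bi_block_decomposition (pverts G) (parcs G) r X Y"
  proof (unfold_locales)
    fix k assume k: "k \<in> {1..r}"
    show "block (X k \<union> Y k) (X k \<times> Y k \<union> Y k \<times> X k)" using bl[OF k] .
    show "X k \<inter> Y k = {}" "X k \<noteq> {} \<and> Y k \<noteq> {}" using bip[OF k] by (simp_all add: bipartition_def)
  next
    fix W F assume W: "block W F"
    then have "\<lparr>pverts = W, parcs = F\<rparr> \<in> blocks G" by (simp add: blocks_iff_block[OF pg cG])
    then obtain k where k: "k \<in> {1..r}" "B k = \<lparr>pverts = W, parcs = F\<rparr>"
      using bij_betw_imp_surj_on[OF bij] by (metis imageE)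
    then have "pverts (B k) = W" by simp
    then show "\<exists>k\<in>{1..r}. W = X k \<union> Y k" using k(1) verts by blast
  next
    fix k j assume k: "k \<in> {1..r}" and j: "j \<in> {1..r}" and eq: "X k \<union> Y k = X j \<union> Y j"
    \<comment> \<open>Both parts are nonempty, so blocks on the same vertex set share two vertices
      and hence coincide, arcs included.\<close>
    obtain x y where xy: "x \<in> X k" "y \<in> Y k" "x \<noteq> y"
      using bip[OF k] unfolding bipartition_def by blast
    have "parcs (B k) = parcs (B j)"
      unfolding arcs[OF k] arcs[OF j]
      by (rule block_eq(2)[OF bl[OF k] bl[OF j], of x y]) (use xy eq in blast)+
    moreover have "pverts (B k) = pverts (B j)" using verts k j eq by simp
    ultimately have "B k = B j" by (simp add: pair_pre_digraph.equality)
    then show "k = j" using bij_betw_imp_inj_on[OF bij] k j by (simp add: inj_on_eq_iff)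
  qed
qed

lemma outer_prod_index:
  assumes "i < dim_vec a" "j < dim_vec b"
  shows "outer_prod a b $$ (i, j) = a $ i * b $ j"
  using assms by (simp add: outer_prod_def scalar_prod_def mat_of_cols_def mat_of_row_def)

theorem theorem5p8:
  fixes G :: "'a pair_pre_digraph"
    and r N :: nat
    and B :: "nat \<Rightarrow> 'a pair_pre_digraph"
    and X Y :: "nat \<Rightarrow> 'a set"
    and m n :: "nat \<Rightarrow> nat"
    and v :: "nat \<Rightarrow> 'a"
    and q :: "'k::real_normed_field"
  assumes "bi_block_graph G"
    and "r > 1"
    and "bij_betw B {1..r} (blocks G)"
    and "\<And>k. k \<in> {1..r} \<Longrightarrow> bipartition (B k) (X k) (Y k)"
    and "\<And>k. k \<in> {1..r} \<Longrightarrow> m k = card (X k)"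
    and "\<And>k. k \<in> {1..r} \<Longrightarrow> n k = card (Y k)"
    and "N = (\<Sum>k = 1..r. m k + n k) - r + 1"
    and "bij_betw v {..<N} (pverts G)"
    and "q \<noteq> - 1"
    and "\<And>k. k \<in> {1..r} \<Longrightarrow> q\<^sup>2 * (of_nat (m k) - 1) * (of_nat (n k) - 1) \<noteq> 1"
    and "\<And>k. k \<in> {1..r} \<Longrightarrow>
           (q + 1)\<^sup>2 * (of_nat (m k) - 1) * (of_nat (n k) - 1) \<noteq> of_nat (m k) * of_nat (n k)"
  shows "q_dist_mat q G N v * L_mat q G r B X Y N v + 1\<^sub>m N
           = outer_prod (vec N (\<lambda>_. 1)) (x_vec q G r X Y N v)"
proof (rule eq_matI)
  interpret bi_block_decomposition "pverts G" "parcs G" r X Y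
    by (rule bi_block_graph_decomposition(1)[OF assms(1,3)]) (rule assms(4))
  have arcs: "parcs (B k) = X k \<times> Y k \<union> Y k \<times> X k" if "k \<in> {1..r}" for k
    using assms(4) that by (rule bi_block_graph_decomposition(2)[OF assms(1,3)])
  have nb: "num_blocks_at G w = card {k \<in> {1..r}. w \<in> X k \<union> Y k}" for w
    by (rule bi_block_graph_decomposition(3)[OF assms(1,3)]) (rule assms(4))
  have pg: "pair_graph G" using assms(1) by (simp add: bi_block_graph_def)
  have D: "Delta q (card (X k)) (card (Y k)) \<noteq> 0" if "k \<in> {1..r}" for k
    using assms(5,6,10)[OF that] by (simp add: Delta_def)
  let ?L = "\<lambda>z w. (\<Sum>k\<in>{1..r}. block_L q (X k) (Y k) z w)
    + of_bool (z = w) * ((of_nat (num_blocks_at G w) - 1) * (q - 1))"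
  fix i j
  assume "i < dim_row (outer_prod (vec N (\<lambda>_. 1)) (x_vec q G r X Y N v))"
    and "j < dim_col (outer_prod (vec N (\<lambda>_. 1)) (x_vec q G r X Y N v))"
  then have i: "i < N" and j: "j < N" by (simp_all add: outer_prod_def x_vec_def)
  have inj: "v l = v l' \<longleftrightarrow> l = l'" if "l < N" "l' < N" for l l'
    using bij_betw_imp_inj_on[OF assms(8)] that by (simp add: inj_on_eq_iff)
  have V: "v l \<in> pverts G" if "l < N" for l using bij_betwE[OF assms(8)] that by blast
  have L: "L_mat q G r B X Y N v $$ (l, j) = ?L (v l) (v j)" if "l < N" for l
    using that j L_entry[OF assms(9) arcs nb, of "v l" "v j"] inj[OF that j]
    by (auto simp: L_mat_def mat_diag_def)
  have "(q_dist_mat q G N v * L_mat q G r B X Y N v + 1\<^sub>m N) $$ (i, j) =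
      (\<Sum>l<N. q_dist_mat q G N v $$ (i, l) * L_mat q G r B X Y N v $$ (l, j)) + of_bool (i = j)"
    using i j by (simp add: q_dist_mat_def L_mat_def scalar_prod_def lessThan_atLeast0)
  also have "(\<Sum>l<N. q_dist_mat q G N v $$ (i, l) * L_mat q G r B X Y N v $$ (l, j)) =
      (\<Sum>l<N. q_int q (rdist (parcs G) (v i) (v l)) * ?L (v l) (v j))"
  proof (rule sum.cong[OF refl])
    fix l assume "l \<in> {..<N}"
    then have l: "l < N" by simp
    then show "q_dist_mat q G N v $$ (i, l) * L_mat q G r B X Y N v $$ (l, j) =
        q_int q (rdist (parcs G) (v i) (v l)) * ?L (v l) (v j)"
      unfolding L[OF l] using i
      by (simp add: q_dist_mat_def pair_graph.graph_dist_eq_rdist[OF pg V[OF i]])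
  qed
  \<comment> \<open>The enumeration \<open>v\<close> turns the sum over matrix indices into a sum
    over vertices, where \<open>row_identity\<close> applies.\<close>
  also have "\<dots> = (\<Sum>z\<in>pverts G. q_int q (rdist (parcs G) (v i) z) * ?L z (v j))"
    by (rule sum.reindex_bij_betw[OF assms(8)])
  also have "\<dots> + of_bool (i = j) = x_entry q G r X Y (v j)"
    unfolding x_entry_eq nb inj[OF i j, symmetric] using D
    by (rule row_identity[OF V[OF i] V[OF j] assms(9)])
  also have "\<dots> = outer_prod (vec N (\<lambda>_. 1)) (x_vec q G r X Y N v) $$ (i, j)"
    using i j by (simp add: outer_prod_index x_vec_def)
  finally show "(q_dist_mat q G N v * L_mat q G r B X Y N v + 1\<^sub>m N) $$ (i, j) =
      outer_prod (vec N (\<lambda>_. 1)) (x_vec q G r X Y N v) $$ (i, j)" .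
qed (simp_all add: outer_prod_def x_vec_def q_dist_mat_def L_mat_def)

end
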